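(* Let $R$ be an integer with $|R|\ge2$ and $B=\{0,b_1,b_2\}$ a three-element subset of $\mathbb{Z}$. Let $L\subset\mathbb{Z}$ be finite with $0\in L$ and $(\alpha_l)_{l\in L}$ nonzero complex numbers with $\alpha_0=1$. The matrix $\frac{1}{\sqrt3}\left(e^{2\pi i lc/R}\alpha_l\right)_{l\in L,c\in B}$ has orthonormal columns if and only if the following four conditions hold: (i) $R=3^\alpha r$ with $\alpha\in\mathbb{N}$ ($\alpha\ge1$) and $r$ not divisible by $3$; (ii) $b_i=3^\beta q_i$ ($i=1,2$) with $\beta\in\mathbb{N}\cup\{0\}$, $\beta\le\alpha-1$, $q_i$ not divisible by $3$, and $q_1\not\equiv q_2\pmod3$; (iii) every $l\in L\setminus\{0\}$ is of the form $l=3^{\alpha-1-\beta}s_l$ with $s_l$ not divisible by $3$ and $q_is_l$ divisible by $r$ for $i=1,2$; (iv) $\sum_{l\in L\setminus\{0\},\ s_l\equiv1\,(\mathrm{mod}\,3)}|\alpha_l|^2=1$ and $\sum_{l\in L\setminus\{0\},\ s_l\equiv2\,(\mathrm{mod}\,3)}|\alpha_l|^2=1$. If in addition (v) there exist $l_1,l_1',l_2,l_2'\in L\setminus\{0\}$ with $s_{l_1}\equiv s_{l_1'}\equiv1\pmod3$, $s_{l_2}\equiv s_{l_2'}\equiv2\pmod3$, $l_1\not\equiv l_1'\pmod R$ and $l_2\not\equiv l_2'\pmod R$, then $\left\{\Big(\prod_{j=0}^k\alpha_{l_j}\Big)e_{l_0+Rl_1+\dots+R^kl_k}: l_0\dots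 l_k\in\Omega(L)\right\}$ is a Parseval frame for $L^2(\mu(R,B))$.
   Context: $\mu(R,B)$ is the unique Borel probability measure on $\mathbb{R}$ with $\mu(E)=\frac13\sum_{c\in B}\mu(\tau_c^{-1}E)$, $\tau_c(x)=(x+c)/R$. $e_\lambda(x)=e^{2\pi i\lambda x}$. $\Omega(L)$: the empty word (giving $e_0$ with weight 1) and all words $l_0\dots l_k$ with $l_i\in L$, $l_k\ne0$. Parseval frame: $\sum_i|\langle v,f_i\rangle|^2=\|v\|^2$ for all $v$. *)

theory Defs
  imports "HOL-Analysis.Analysis" "HOL-Probability.Probability"
begin

definition expo :: "real \<Rightarrow> real \<Rightarrow> complex" where
  "expo lam x = exp (2 * pi * \<i> * complex_of_real (lam * x))"

text \<open>mu is a Borel probability measure on the reals satisfying the self-similarity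
  identity mu(E) = 1/3 sum_{c in B} mu(tau_c^{-1} E), tau_c(x) = (x+c)/R.
  (For |R| >= 2 such a measure exists and is unique; this is mu(R,B).)\<close>
definition self_similar_measure :: "int \<Rightarrow> int set \<Rightarrow> real measure \<Rightarrow> bool" where
  "self_similar_measure R B \<mu> \<longleftrightarrow>
     prob_space \<mu> \<and> sets \<mu> = sets borel \<and>
     (\<forall>E \<in> sets borel. measure \<mu> E =
        (1/3) * (\<Sum>c\<in>B. measure \<mu> ((\<lambda>x. (x + of_int c) / of_int R) -` E)))"

definition Omega :: "int set \<Rightarrow> int list set" where
  "Omega L = {[]} \<union> {w. w \<noteq> [] \<and> set w \<subseteq> L \<and> last w \<noteq> 0}"

definition word_freq :: "int \<Rightarrow> int list \<Rightarrow> int" where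
  "word_freq R w = (\<Sum>j<length w. R ^ j * w ! j)"

definition word_coeff :: "(int \<Rightarrow> complex) \<Rightarrow> int list \<Rightarrow> complex" where
  "word_coeff a w = (\<Prod>j<length w. a (w ! j))"

definition parseval_frame :: "real measure \<Rightarrow> 'i set \<Rightarrow> ('i \<Rightarrow> real \<Rightarrow> complex) \<Rightarrow> bool" where
  "parseval_frame \<mu> I F \<longleftrightarrow>
     (\<forall>f :: real \<Rightarrow> complex. f \<in> borel_measurable \<mu> \<and> integrable \<mu> (\<lambda>x. (norm (f x))\<^sup>2) \<longrightarrow>
        ((\<lambda>i. (norm (LINT x|\<mu>. f x * cnj (F i x)))\<^sup>2) has_sum (LINT x|\<mu>. (norm (f x))\<^sup>2)) I)"

end

theory Submission
  imports Defs
begin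

text \<open>
  If the columns are orthonormal, the row of \<open>l = 0\<close>, a unit vector, is orthogonal to all other rows, so
  \<open>1 + e(l b\<^sub>1/R) + e(l b\<^sub>2/R) = 0\<close> for \<open>l \<noteq> 0\<close>; the two exponentials are then the primitive cube roots of
  unity, and comparing 3-adic valuations gives the factorisations.

  For the frame, self-similarity gives \<open>\<langle>f, e\<^bsub>l+R\<lambda>\<^esub>\<rangle> = \<langle>T\<^sub>l f, e\<^sub>\<lambda>\<rangle>\<close>, where
  \<open>\<Sum>\<^sub>l |\<alpha>\<^sub>l|\<^sup>2 \<parallel>T\<^sub>l f\<parallel>\<^sup>2 = \<parallel>f\<parallel>\<^sup>2\<close> and \<open>T\<^sub>l e\<^sub>t\<close> is a multiple of \<open>e\<^bsub>(t-l)/R\<^esub>\<close>.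
  Hence the words form a Bessel system with bound 1, and the Bessel defect \<open>g(t)\<close> of \<open>e\<^sub>t\<close> satisfies
  \<open>g(t) = \<Sum>\<^sub>l |\<alpha>\<^sub>l m((t-l)/R)|\<^sup>2 g((t-l)/R)\<close> with weights of sum 1 and \<open>g(0) = 0\<close>. On an interval invariant
  under all \<open>t \<mapsto> (t-l)/R\<close> the upper semicontinuous function \<open>g\<close> attains its maximum; if this is positive, every
  maximum point reaches a zero of the mask \<open>m\<close> under repeated division by \<open>R\<close> (otherwise 0 would be a maximum
  point), so the set of maximum points is finite. Multiplication by \<open>R\<close> maps it modulo 1 onto itself, hence injectively,
  but a zero of the mask has two successors that differ modulo 1 by condition (v). So \<open>g = 0\<close>, and the exponentials
  are total in \<open>L\<^sup>2(\<mu>)\<close> because \<open>\<mu>\<close> has bounded support.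
\<close>

section \<open>Roots of unity and orthogonality\<close>

definition unit_exp :: "real \<Rightarrow> complex" where
  "unit_exp x = cis (2 * pi * x)"

lemma unit_exp_add: "unit_exp (x + y) = unit_exp x * unit_exp y"
  by (simp add: unit_exp_def cis_mult algebra_simps)

lemma unit_exp_0 [simp]: "unit_exp 0 = 1"
  by (simp add: unit_exp_def)

lemma norm_unit_exp [simp]: "norm (unit_exp x) = 1"
  by (simp add: unit_exp_def)

lemma cnj_unit_exp: "cnj (unit_exp x) = unit_exp (- x)"
  by (simp add: unit_exp_def cis_cnj)

lemma unit_exp_diff: "unit_exp (x - y) = unit_exp x * cnj (unit_exp y)"
  by (simp add: cnj_unit_exp flip: unit_exp_add)

lemma unit_exp_eq_1_iff: "unit_exp x = 1 \<longleftrightarrow> x \<in> \<int>"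
proof -
  have "unit_exp x = exp (\<i> * complex_of_real (2 * pi * x))"
    by (simp add: unit_exp_def cis_conv_exp)
  then have "unit_exp x = 1 \<longleftrightarrow> (\<exists>n::int. 2 * pi * x = of_int (2 * n) * pi)"
    by (simp add: exp_eq_1)
  also have "\<dots> \<longleftrightarrow> (\<exists>n::int. x = of_int n)"
    by (intro ex_cong1) auto
  finally show ?thesis
    by (auto simp: Ints_def)
qed

lemma unit_exp_Ints: "x \<in> \<int> \<Longrightarrow> unit_exp x = 1"
  by (simp add: unit_exp_eq_1_iff)

lemma unit_exp_cong: "x - y \<in> \<int> \<Longrightarrow> unit_exp x = unit_exp y"
  using unit_exp_add[of "x - y" y] by (simp add: unit_exp_Ints)

lemma continuous_on_unit_exp [continuous_intros]:
  "continuous_on A f \<Longrightarrow> continuous_on A (\<lambda>x. unit_exp (f x))"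
  unfolding unit_exp_def by (intro continuous_intros)

lemma expo_eq_unit_exp: "expo lam x = unit_exp (lam * x)"
  by (simp add: expo_def unit_exp_def cis_conv_exp mult_ac)

text \<open>Comparing |z| = 1 with |-1 - z| = 1 forces Re z = -1/2, so z is a primitive cube root of
  unity and w is its conjugate z^2.\<close>

lemma unit_complex_sum_zeroD:
  fixes z w :: complex
  assumes "norm z = 1" "norm w = 1" "1 + z + w = 0"
  shows "z\<^sup>2 + z + 1 = 0" "w = z\<^sup>2" "z ^ 3 = 1" "z \<noteq> 1"
proof -
  have w: "w = - 1 - z" using assms(3) by (simp add: algebra_simps add_eq_0_iff)
  have 1: "(Re z)\<^sup>2 + (Im z)\<^sup>2 = 1"
    using assms(1) by (metis cmod_power2 one_power2)
  have 2: "(- 1 - Re z)\<^sup>2 + (Im z)\<^sup>2 = 1"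
    using assms(2) unfolding w by (simp add: cmod_def)
  have re: "Re z = - 1/2" using 1 2 by (simp add: power2_eq_square algebra_simps)
  have im: "(Im z)\<^sup>2 = 3/4" using 1 by (simp add: re power2_eq_square)
  show a: "z\<^sup>2 + z + 1 = 0"
    using im by (simp add: complex_eq_iff re power2_eq_square)
  have "w - z\<^sup>2 = - (z\<^sup>2 + z + 1)" by (simp add: w)
  with a show "w = z\<^sup>2" by simp
  have "z ^ 3 - 1 = (z - 1) * (z\<^sup>2 + z + 1)"
    by (simp add: algebra_simps power2_eq_square power3_eq_cube)
  with a show "z ^ 3 = 1" by simp
  show "z \<noteq> 1" using re by auto
qed

lemma unit_exp_power: "unit_exp x ^ n = unit_exp (real n * x)"
  by (simp add: unit_exp_def Complex.DeMoivre mult_ac)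

lemma unit_exp_third_root:
  assumes "\<not> 3 dvd (k::int)"
  defines "z \<equiv> unit_exp (of_int k / 3)"
  shows "z\<^sup>2 + z + 1 = 0" "z ^ 3 = 1"
proof -
  have "z \<noteq> 1"
  proof
    assume "z = 1"
    then obtain n :: int where "of_int k / 3 = (of_int n :: real)"
      by (auto simp: z_def unit_exp_eq_1_iff Ints_def)
    then have "real_of_int k = of_int (3 * n)" by simp
    then have "k = 3 * n" by linarith
    with assms show False by simp
  qed
  moreover show *: "z ^ 3 = 1"
    by (simp add: z_def unit_exp_power unit_exp_Ints)
  have "(z - 1) * (z\<^sup>2 + z + 1) = z ^ 3 - 1"
    by (simp add: algebra_simps power2_eq_square power3_eq_cube)
  ultimately show "z\<^sup>2 + z + 1 = 0" using * by simp
qed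

lemma primitive_cube_root_cases:
  fixes z w :: complex
  assumes "z\<^sup>2 + z + 1 = 0" "w\<^sup>2 + w + 1 = 0"
  shows "w = z \<or> w = z\<^sup>2"
proof -
  \<comment> \<open>This displays z and z^2 as the two roots of X^2 + X + 1: every term on the right
    contains one of the vanishing quadratics as a factor.\<close>
  have "(w - z) * (w - z\<^sup>2) = (w\<^sup>2 + w + 1) - (z\<^sup>2 + z + 1) * w + (z - 1) * (z\<^sup>2 + z + 1)"
    by (simp add: algebra_simps power2_eq_square)
  then show ?thesis using assms by auto
qed

text \<open>Since z is not real, 1 and z are linearly independent over the reals; substituting -1 -
  z for z^2 and comparing coefficients gives P = Q and Q = 1.\<close>

lemma weights_eq_1_of_cube_root:
  fixes z :: complex and P Q :: real
  assumes "z\<^sup>2 + z + 1 = 0" "1 + of_real P * z + of_real Q * z\<^sup>2 = 0"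
  shows "P = 1" "Q = 1"
proof -
  have z2: "z\<^sup>2 = - 1 - z" using assms(1) by (simp add: eq_neg_iff_add_eq_0 algebra_simps)
  have im: "Im z \<noteq> 0"
  proof
    assume "Im z = 0"
    then have "(Re z)\<^sup>2 + Re z + 1 = 0"
      using arg_cong[OF assms(1), of Re] by (simp add: power2_eq_square)
    moreover have "(Re z)\<^sup>2 + Re z + 1 = (Re z + 1/2)\<^sup>2 + 3/4"
      by (simp add: power2_eq_square algebra_simps)
    moreover have "(Re z + 1/2)\<^sup>2 \<ge> 0" by simp
    ultimately show False by linarith
  qed
  have "(1 - Q) + of_real (P - Q) * z = 0"
    using assms(2) unfolding z2 by (simp add: algebra_simps)
  then have "P - Q = 0" "1 - Q + (P - Q) * Re z = 0"
    using im by (auto simp: complex_eq_iff)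
  then show "P = 1" "Q = 1" by auto
qed

section \<open>The Gram matrix of the columns and its isometry property\<close>

definition orthogonal_columns :: "int \<Rightarrow> int set \<Rightarrow> int set \<Rightarrow> (int \<Rightarrow> complex) \<Rightarrow> bool" where
  "orthogonal_columns R B L a \<longleftrightarrow>
     (\<forall>c\<in>B. \<forall>c'\<in>B. (\<Sum>l\<in>L. of_real ((cmod (a l))\<^sup>2) * unit_exp (of_int (l * (c - c')) / of_int R))
        = (if c = c' then 3 else 0))"

text \<open>Clears the factor 1/3 and merges the two exponentials into one. The phases of the
  weights cancel, so \<open>orthogonal_columns\<close> involves only their moduli; despite its name
  it also contains the normalisation of the columns, through the diagonal value 3.\<close>

lemma orthonormal_columns_iff:
  "(\<forall>c\<in>B. \<forall>c'\<in>B.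
     (\<Sum>l\<in>L. (exp (2 * pi * \<i> * of_int (l * c) / of_int R) * a l / sqrt 3)
             * cnj (exp (2 * pi * \<i> * of_int (l * c') / of_int R) * a l / sqrt 3))
     = (if c = c' then 1 else 0)) \<longleftrightarrow> orthogonal_columns R B L a"
proof -
  have e: "exp (2 * pi * \<i> * of_int n / of_int R) = unit_exp (of_int n / of_int R)" for n
    by (simp add: unit_exp_def cis_conv_exp mult_ac)
  have s3: "complex_of_real (sqrt 3) * complex_of_real (sqrt 3) = 3"
    by (simp flip: of_real_mult)
  have "(exp (2 * pi * \<i> * of_int (l * c) / of_int R) * a l / sqrt 3)
      * cnj (exp (2 * pi * \<i> * of_int (l * c') / of_int R) * a l / sqrt 3)
    = of_real ((cmod (a l))\<^sup>2) * unit_exp (of_int (l * (c - c')) / of_int R) / 3" for l c c'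
  proof -
    have "unit_exp (of_int (l * (c - c')) / of_int R)
        = unit_exp (of_int (l * c) / of_int R) * cnj (unit_exp (of_int (l * c') / of_int R))"
      by (simp add: algebra_simps diff_divide_distrib flip: unit_exp_diff)
    then show ?thesis
      unfolding e by (simp add: s3 complex_norm_square mult_ac del: of_real_power)
  qed
  then have "(\<Sum>l\<in>L. (exp (2 * pi * \<i> * of_int (l * c) / of_int R) * a l / sqrt 3)
             * cnj (exp (2 * pi * \<i> * of_int (l * c') / of_int R) * a l / sqrt 3))
    = (\<Sum>l\<in>L. of_real ((cmod (a l))\<^sup>2) * unit_exp (of_int (l * (c - c')) / of_int R)) / 3" for c c'
    by (simp only: sum_divide_distrib)
  moreover have "x / 3 = (if P then 1 else 0) \<longleftrightarrow> x = (if P then 3 else 0)" for x :: complex and P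
    by auto
  ultimately show ?thesis
    unfolding orthogonal_columns_def by (simp only:)
qed

text \<open>A matrix with orthonormal columns is an isometry; the proof expands the squares and
  recognises the Gram entries. The minus sign conjugates the exponentials, which preserves
  orthonormality; it is the form in which they occur in \<open>transfer\<close>.\<close>

lemma orthogonal_columns_pythagoras:
  assumes "orthogonal_columns R B L a" "finite B"
  shows "(\<Sum>l\<in>L. (cmod (a l))\<^sup>2 * (cmod (\<Sum>c\<in>B. unit_exp (- of_int (l * c) / of_int R) * v c))\<^sup>2)
    = 3 * (\<Sum>c\<in>B. (cmod (v c))\<^sup>2)"
proof -
  let ?E = "\<lambda>n::int. unit_exp (of_int n / of_int R)"
  have "complex_of_real (\<Sum>l\<in>L. (cmod (a l))\<^sup>2 * (cmod (\<Sum>c\<in>B. unit_exp (- of_int (l * c) / of_int R) * v c))\<^sup>2)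
    = (\<Sum>l\<in>L. of_real ((cmod (a l))\<^sup>2) * (\<Sum>c\<in>B. \<Sum>c'\<in>B. ?E (l * (c' - c)) * (v c * cnj (v c'))))"
  proof (simp add: complex_norm_square del: of_real_power, intro sum.cong refl arg_cong2[where f="(*)"])
    fix l
    have "(\<Sum>c\<in>B. unit_exp (- (of_int l * of_int c / of_int R)) * v c) * (\<Sum>x\<in>B. cnj (unit_exp (- (of_int l * of_int x / of_int R))) * cnj (v x))
      = (\<Sum>c\<in>B. \<Sum>c'\<in>B. (unit_exp (- (of_int l * of_int c / of_int R)) * unit_exp (of_int l * of_int c' / of_int R)) * (v c * cnj (v c')))"
      by (simp add: sum_product cnj_unit_exp mult_ac)
    also have "\<dots> = (\<Sum>c\<in>B. \<Sum>c'\<in>B. unit_exp (of_int l * (of_int c' - of_int c) / of_int R) * (v c * cnj (v c')))"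
      by (simp add: right_diff_distrib diff_divide_distrib flip: unit_exp_add)
    finally show "(\<Sum>c\<in>B. unit_exp (- (of_int l * of_int c / of_int R)) * v c) * (\<Sum>x\<in>B. cnj (unit_exp (- (of_int l * of_int x / of_int R))) * cnj (v x))
      = (\<Sum>c\<in>B. \<Sum>c'\<in>B. unit_exp (of_int l * (of_int c' - of_int c) / of_int R) * (v c * cnj (v c')))" .
  qed
  also have "\<dots> = (\<Sum>l\<in>L. \<Sum>c\<in>B. \<Sum>c'\<in>B. of_real ((cmod (a l))\<^sup>2) * ?E (l * (c' - c)) * (v c * cnj (v c')))"
    by (simp add: sum_distrib_left mult_ac)
  also have "\<dots> = (\<Sum>c\<in>B. \<Sum>c'\<in>B. \<Sum>l\<in>L. of_real ((cmod (a l))\<^sup>2) * ?E (l * (c' - c)) * (v c * cnj (v c')))"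
    by (subst sum.swap, rule sum.cong[OF refl], rule sum.swap)
  also have "\<dots> = (\<Sum>c\<in>B. \<Sum>c'\<in>B. (if c' = c then 3 * (v c * cnj (v c')) else 0))"
  proof (intro sum.cong refl)
    fix c c' assume "c \<in> B" "c' \<in> B"
    then have "(\<Sum>l\<in>L. of_real ((cmod (a l))\<^sup>2) * ?E (l * (c' - c))) = (if c' = c then 3 else 0)"
      using assms(1) unfolding orthogonal_columns_def by blast
    then show "(\<Sum>l\<in>L. of_real ((cmod (a l))\<^sup>2) * ?E (l * (c' - c)) * (v c * cnj (v c')))
      = (if c' = c then 3 * (v c * cnj (v c')) else 0)"
      unfolding sum_distrib_right[symmetric] by simp
  qed
  also have "\<dots> = of_real (3 * (\<Sum>c\<in>B. (cmod (v c))\<^sup>2))"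
    using assms(2) by (simp add: sum_distrib_left complex_norm_square del: of_real_power)
  finally show ?thesis by (simp only: of_real_eq_iff)
qed

text \<open>Applying the isometry to the constant vector 1 gives the total 9, which the row l = 0
  contributes alone; hence every other row annihilates the constant vector.\<close>

lemma orthogonal_columns_row_sum_zero:
  assumes "orthogonal_columns R B L a" "card B = 3" "finite L" "0 \<in> L" "a 0 = 1"
    and "l \<in> L" "l \<noteq> 0" "a l \<noteq> 0"
  shows "(\<Sum>c\<in>B. unit_exp (of_int (l * c) / of_int R)) = 0"
proof -
  have fin: "finite B" using assms(2) by (rule_tac card_ge_0_finite) simp
  let ?g = "\<lambda>l. (cmod (a l))\<^sup>2 * (cmod (\<Sum>c\<in>B. unit_exp (- of_int (l * c) / of_int R)))\<^sup>2"
  have "(\<Sum>l\<in>L. ?g l) = 9"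
    using orthogonal_columns_pythagoras[OF assms(1) fin, of "\<lambda>_. 1"] assms(2) by simp
  moreover have "(\<Sum>l\<in>L. ?g l) = ?g 0 + (\<Sum>l\<in>L - {0}. ?g l)"
    using assms by (intro sum.remove) auto
  moreover have "?g 0 = 9" using assms by simp
  ultimately have "(\<Sum>l\<in>L - {0}. ?g l) = 0" by simp
  then have "?g l = 0"
    using assms by (subst (asm) sum_nonneg_eq_0_iff) auto
  then have "(\<Sum>c\<in>B. unit_exp (- of_int (l * c) / of_int R)) = 0"
    using assms by simp
  then have "cnj (\<Sum>c\<in>B. unit_exp (- of_int (l * c) / of_int R)) = 0"
    by (simp only: complex_cnj_zero)
  then show ?thesis by (simp add: cnj_unit_exp)
qed

section \<open>Factorisation by 3-adic valuation and residue classes modulo 3\<close>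

lemma unit_exp_factored_ratio:
  fixes R r q s l :: int
  assumes "1 \<le> \<alpha>" "R = 3 ^ \<alpha> * r" "r \<noteq> 0" "\<beta> \<le> \<alpha> - 1"
    and "l = 3 ^ (\<alpha> - 1 - \<beta>) * s" "r dvd q * s" "\<not> 3 dvd r"
  shows "unit_exp (of_int (l * (3 ^ \<beta> * q)) / of_int R) = unit_exp (of_int (r * q) / 3) ^ nat (s mod 3)"
proof -
  obtain k where k: "q * s = r * k" using assms(6) by (auto simp: dvd_def)
  have pw: "(3::int) ^ (\<alpha> - 1 - \<beta>) * 3 ^ \<beta> * 3 = 3 ^ \<alpha>"
  proof -
    have "(3::int) ^ (\<alpha> - 1 - \<beta>) * 3 ^ \<beta> * 3 = 3 ^ ((\<alpha> - 1 - \<beta>) + \<beta> + 1)"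
      by (simp only: power_add power_one_right)
    also have "(\<alpha> - 1 - \<beta>) + \<beta> + 1 = \<alpha>" using assms by simp
    finally show ?thesis .
  qed
  \<comment> \<open>All powers of 3 cancel, leaving k/3 with k = q s / r in place of l b /
    R.\<close>
  have "l * (3 ^ \<beta> * q) * 3 = (3 ^ (\<alpha> - 1 - \<beta>) * 3 ^ \<beta> * 3) * (q * s)"
    by (subst assms(5)) (simp only: mult_ac)
  also have "\<dots> = R * k" unfolding pw k assms(2) by (simp only: mult_ac)
  finally have "l * (3 ^ \<beta> * q) * 3 = R * k" .
  then have "real_of_int (l * (3 ^ \<beta> * q)) * 3 = of_int R * of_int k"
    by (metis of_int_mult of_int_numeral)
  then have 1: "real_of_int (l * (3 ^ \<beta> * q)) / of_int R = of_int k / 3"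
    using assms by (simp add: field_simps)
  \<comment> \<open>As r is its own inverse modulo 3, k = q s / r is congruent to r q s; so only the
    class of s modulo 3 matters.\<close>
  have "(r * r) mod 3 = 1"
  proof -
    have "r mod 3 = 1 \<or> r mod 3 = 2" using assms(7) by presburger
    then show ?thesis by (auto simp: mod_mult_eq[of r 3 r, symmetric])
  qed
  then have "(r * r) mod 3 = 1 mod 3" by simp
  then have "3 dvd k * (r * r - 1)" by (intro dvd_mult) (simp only: mod_eq_dvd_iff)
  moreover have "k - r * q * (s mod 3) = r * q * (s - s mod 3) - k * (r * r - 1)"
    using k by algebra
  moreover have "3 dvd (s - s mod 3)" by (simp add: minus_mod_eq_mult_div)
  ultimately have "3 dvd (k - r * q * (s mod 3))" by (metis dvd_diff dvd_mult)
  then obtain j where j: "k - r * q * (s mod 3) = 3 * j" by (auto simp: dvd_def)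
  have "unit_exp (of_int k / 3) = unit_exp (of_int (s mod 3) * (of_int (r * q) / 3))"
  proof (rule unit_exp_cong)
    have "real_of_int (k - r * q * (s mod 3)) = of_int (3 * j)" by (simp only: j)
    then have "real_of_int k / 3 - of_int (s mod 3) * (of_int (r * q) / 3) = of_int j"
      by (simp add: field_simps)
    then show "real_of_int k / 3 - of_int (s mod 3) * (of_int (r * q) / 3) \<in> \<int>" by simp
  qed
  also have "\<dots> = unit_exp (of_int (r * q) / 3) ^ nat (s mod 3)"
  proof -
    have "real_of_int (s mod 3) = real (nat (s mod 3))" by simp
    then show ?thesis unfolding unit_exp_power by presburger
  qed
  finally show ?thesis unfolding 1 .
qed

text \<open>A Gram entry sorted by the residue class of \<open>s l\<close>: the row l = 0 gives 1,
  every other row a multiple of z or z^2. Here q may be a multiple of 3; \<open>q = 0\<close> covers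
  the diagonal.\<close>

lemma weighted_sum_unit_exp:
  fixes R r q :: int and L :: "int set" and a :: "int \<Rightarrow> complex" and s :: "int \<Rightarrow> int"
  assumes "finite L" "0 \<in> L" "a 0 = 1"
    and st: "1 \<le> \<alpha>" "R = 3 ^ \<alpha> * r" "r \<noteq> 0" "\<beta> \<le> \<alpha> - 1" "\<not> 3 dvd r"
    and l: "\<And>l. l \<in> L - {0} \<Longrightarrow> l = 3 ^ (\<alpha> - 1 - \<beta>) * s l \<and> \<not> 3 dvd s l \<and> r dvd q * s l"
  defines "z \<equiv> unit_exp (of_int (r * q) / 3)"
  shows "(\<Sum>l\<in>L. of_real ((cmod (a l))\<^sup>2) * unit_exp (of_int (l * (3 ^ \<beta> * q)) / of_int R))
    = 1 + of_real (\<Sum>l\<in>{l\<in>L - {0}. s l mod 3 = 1}. (cmod (a l))\<^sup>2) * z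
        + of_real (\<Sum>l\<in>{l\<in>L - {0}. s l mod 3 = 2}. (cmod (a l))\<^sup>2) * z\<^sup>2"
proof -
  let ?g = "\<lambda>l. of_real ((cmod (a l))\<^sup>2) * unit_exp (of_int (l * (3 ^ \<beta> * q)) / of_int R)"
  let ?L = "\<lambda>i. {l\<in>L - {0}. s l mod 3 = i}"
  have split: "L - {0} = ?L 1 \<union> ?L 2"
  proof
    show "L - {0} \<subseteq> ?L 1 \<union> ?L 2"
    proof
      fix x assume x: "x \<in> L - {0}"
      then have "\<not> 3 dvd s x" using l by blast
      then have "s x mod 3 = 1 \<or> s x mod 3 = 2" by presburger
      with x show "x \<in> ?L 1 \<union> ?L 2" by blast
    qed
  qed auto
  have g: "?g x = of_real ((cmod (a x))\<^sup>2) * z ^ nat (s x mod 3)" if "x \<in> L - {0}" for x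
    using l[OF that] st unfolding z_def by (subst unit_exp_factored_ratio[of \<alpha> R r \<beta> x "s x" q]) auto
  have "sum ?g L = ?g 0 + sum ?g (L - {0})"
    using assms by (intro sum.remove) auto
  also have "?g 0 = 1" using assms by simp
  also have "sum ?g (L - {0}) = sum ?g (?L 1) + sum ?g (?L 2)"
    by (subst split, rule sum.union_disjoint) (use assms in auto)
  also have "sum ?g (?L 1) = (\<Sum>l\<in>?L 1. of_real ((cmod (a l))\<^sup>2) * z)"
    by (intro sum.cong refl) (subst g, auto)
  also have "sum ?g (?L 2) = (\<Sum>l\<in>?L 2. of_real ((cmod (a l))\<^sup>2) * z\<^sup>2)"
    by (intro sum.cong refl) (subst g, auto)
  finally show ?thesis by (simp add: sum_distrib_right)
qed

lemma unit_exp_ratio_cube_eq_1D: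
  fixes n R :: int
  assumes "R \<noteq> 0" "unit_exp (of_int n / of_int R) ^ 3 = 1" "unit_exp (of_int n / of_int R) \<noteq> 1"
  obtains k :: int where "3 * n = R * k" "\<not> 3 dvd k"
proof -
  have "3 * (of_int n / of_int R) \<in> (\<int> :: real set)"
    using assms(2) by (simp add: unit_exp_power unit_exp_eq_1_iff)
  then obtain k :: int where k: "3 * (of_int n / of_int R) = real_of_int k"
    by (auto simp: Ints_def)
  then have "real_of_int (3 * n) = real_of_int (R * k)"
    using assms(1) by (simp add: field_simps)
  then have 1: "3 * n = R * k" by linarith
  moreover have "\<not> 3 dvd k"
  proof
    assume "3 dvd k"
    then obtain j where "k = 3 * j" by (auto simp: dvd_def)
    then have "of_int n / of_int R = real_of_int j" using k by simp
    then show False using assms(3) by (simp add: unit_exp_Ints)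
  qed
  ultimately show thesis by (rule that)
qed

lemma orthogonal_columns_three_sum:
  fixes R b1 b2 :: int
  assumes "orthogonal_columns R {0, b1, b2} L a" "b1 \<noteq> 0" "b2 \<noteq> 0" "b1 \<noteq> b2"
    and "finite L" "0 \<in> L" "a 0 = 1" "\<forall>l\<in>L. a l \<noteq> 0" "l \<in> L" "l \<noteq> 0"
  shows "1 + unit_exp (of_int (l * b1) / of_int R) + unit_exp (of_int (l * b2) / of_int R) = 0"
proof -
  have "(\<Sum>c\<in>{0, b1, b2}. unit_exp (of_int (l * c) / of_int R)) = 0"
    by (rule orthogonal_columns_row_sum_zero[OF assms(1)]) (use assms in auto)
  then show ?thesis using assms(2-4) by (simp add: add_ac)
qed

text \<open>For each nonzero l in L the exponentials of l b_i / R are primitive cube roots of unity,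
  that is, 3 l b_i = R k_i with k_i prime to 3. The 3-adic valuation v then satisfies 1 + v(l) +
  v(b_i) = v(R); hence b1 and b2 have the same valuation, and that of l is determined.\<close>

lemma orthogonal_columns_imp_factorisation:
  fixes R b1 b2 :: int and L :: "int set" and a :: "int \<Rightarrow> complex"
  assumes R: "R \<noteq> 0"
    and B: "b1 \<noteq> 0" "b2 \<noteq> 0" "b1 \<noteq> b2"
    and L: "finite L" "0 \<in> L"
    and a: "\<forall>l\<in>L. a l \<noteq> 0" "a 0 = 1"
    and orth: "orthogonal_columns R {0, b1, b2} L a"
  shows "\<exists>(\<alpha>::nat) (r::int) (\<beta>::nat) (q1::int) (q2::int) (s::int \<Rightarrow> int).
         \<alpha> \<ge> 1 \<and> R = 3 ^ \<alpha> * r \<and> \<not> 3 dvd r \<and>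
         b1 = 3 ^ \<beta> * q1 \<and> b2 = 3 ^ \<beta> * q2 \<and> \<beta> \<le> \<alpha> - 1 \<and>
         \<not> 3 dvd q1 \<and> \<not> 3 dvd q2 \<and> q1 mod 3 \<noteq> q2 mod 3 \<and>
         (\<forall>l\<in>L - {0}. l = 3 ^ (\<alpha> - 1 - \<beta>) * s l \<and> \<not> 3 dvd s l \<and>
                        r dvd q1 * s l \<and> r dvd q2 * s l) \<and>
         (\<Sum>l\<in>{l\<in>L - {0}. s l mod 3 = 1}. (cmod (a l))\<^sup>2) = 1 \<and>
         (\<Sum>l\<in>{l\<in>L - {0}. s l mod 3 = 2}. (cmod (a l))\<^sup>2) = 1"
proof -
  have thirds: "\<exists>k1 k2. 3 * (l * b1) = R * k1 \<and> 3 * (l * b2) = R * k2 \<and>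
      \<not> 3 dvd k1 \<and> \<not> 3 dvd k2 \<and> 3 dvd k1 + k2" if "l \<in> L - {0}" for l
  proof -
    define z where "z = unit_exp (of_int (l * b1) / of_int R)"
    define w where "w = unit_exp (of_int (l * b2) / of_int R)"
    have nrm: "norm z = 1" "norm w = 1" by (auto simp: z_def w_def)
    have zw: "1 + z + w = 0"
      unfolding z_def w_def by (rule orthogonal_columns_three_sum[OF orth]) (use that assms in auto)
    then have wz: "1 + w + z = 0" by (simp add: add_ac)
    note z = unit_complex_sum_zeroD[OF nrm zw] and w = unit_complex_sum_zeroD[OF nrm(2,1) wz]
    obtain k1 where k1: "3 * (l * b1) = R * k1" "\<not> 3 dvd k1"
      using unit_exp_ratio_cube_eq_1D[OF R] z(3,4) unfolding z_def by metis
    obtain k2 where k2: "3 * (l * b2) = R * k2" "\<not> 3 dvd k2"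
      using unit_exp_ratio_cube_eq_1D[OF R] w(3,4) unfolding w_def by metis
    \<comment> \<open>The two roots are inverse to each other, so k1 and k2 are opposite modulo 3;
      this later separates q1 from q2 modulo 3.\<close>
    have "z * w = 1" using z(2,3) by (simp add: power2_eq_square power3_eq_cube mult.assoc)
    then have "of_int (l * b1) / of_int R + of_int (l * b2) / of_int R \<in> (\<int> :: real set)"
      by (simp add: z_def w_def flip: unit_exp_add unit_exp_eq_1_iff)
    then obtain j :: int where j: "of_int (l * b1) / of_int R + of_int (l * b2) / of_int R = real_of_int j"
      by (auto simp: Ints_def)
    then have "real_of_int (l * b1 + l * b2) = of_int (R * j)"
      using R by (simp add: field_simps)
    then have "l * b1 + l * b2 = R * j" by linarith
    then have "R * (k1 + k2) = R * (3 * j)"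
      using k1 k2 by (simp add: algebra_simps)
    then have "k1 + k2 = 3 * j" using R by simp
    then have "3 dvd k1 + k2" by simp
    with k1 k2 show ?thesis by blast
  qed
  \<comment> \<open>With L = {0} the diagonal value in \<open>orthogonal_columns\<close> would be 1
    instead of 3. The letter l0 serves to derive the facts that do not mention a letter.\<close>
  obtain l0 where l0: "l0 \<in> L - {0}"
  proof -
    have "L - {0} \<noteq> {}"
    proof
      assume "L - {0} = {}"
      then have "L = {0}" using L by auto
      moreover have "(\<Sum>l\<in>L. of_real ((cmod (a l))\<^sup>2) * unit_exp (of_int (l * (0 - 0)) / of_int R)) = 3"
        using orth unfolding orthogonal_columns_def by auto
      ultimately show False using a by simp
    qed
    then show thesis using that by blast
  qed
  have p3: "prime_elem (3::int)" by simp
  let ?v = "\<lambda>x::int. multiplicity 3 x"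
  have decomp: "\<exists>y. x = 3 ^ ?v x * y \<and> \<not> 3 dvd y" if "x \<noteq> 0" for x :: int
    using multiplicity_decompose'[of x 3] that by (metis p3 prime_elem_not_unit)
  define \<alpha> where "\<alpha> = ?v R"
  define \<beta> where "\<beta> = ?v b1"
  have val: "1 + ?v l + ?v b1 = \<alpha>" "1 + ?v l + ?v b2 = \<alpha>" if l: "l \<in> L - {0}" for l
  proof -
    obtain k1 k2 where k: "3 * (l * b1) = R * k1" "3 * (l * b2) = R * k2" "\<not> 3 dvd k1" "\<not> 3 dvd k2"
      using thirds[OF l] by blast
    have "k1 \<noteq> 0" "k2 \<noteq> 0" using k by auto
    then have "?v (R * k1) = \<alpha>" "?v (R * k2) = \<alpha>"
      using k R by (simp_all add: prime_elem_multiplicity_mult_distrib[OF p3] not_dvd_imp_multiplicity_0 \<alpha>_def)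
    moreover have "?v (3 * (l * b)) = 1 + ?v l + ?v b" if "b \<noteq> 0" for b
      using l that by (simp add: prime_elem_multiplicity_mult_distrib[OF p3])
    ultimately show "1 + ?v l + ?v b1 = \<alpha>" "1 + ?v l + ?v b2 = \<alpha>"
      using k B by metis+
  qed
  obtain r where r: "R = 3 ^ \<alpha> * r" "\<not> 3 dvd r" using decomp[OF R] by (auto simp: \<alpha>_def)
  obtain q1 where q1: "b1 = 3 ^ \<beta> * q1" "\<not> 3 dvd q1" using decomp[OF B(1)] by (auto simp: \<beta>_def)
  have "?v b2 = \<beta>" using val[OF l0] by (simp add: \<beta>_def)
  then obtain q2 where q2: "b2 = 3 ^ \<beta> * q2" "\<not> 3 dvd q2" using decomp[OF B(2)] by auto
  have \<alpha>\<beta>: "\<alpha> \<ge> 1" "\<beta> \<le> \<alpha> - 1" using val[OF l0] by (auto simp: \<beta>_def)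
  have vl: "?v l = \<alpha> - 1 - \<beta>" if "l \<in> L - {0}" for l using val[OF that] by (simp add: \<beta>_def)
  have "\<forall>l. \<exists>y. l \<in> L - {0} \<longrightarrow> l = 3 ^ (\<alpha> - 1 - \<beta>) * y \<and> \<not> 3 dvd y"
    using decomp vl by fastforce
  then obtain s where s: "l = 3 ^ (\<alpha> - 1 - \<beta>) * s l" "\<not> 3 dvd s l" if "l \<in> L - {0}" for l
    by metis
  have r0: "r \<noteq> 0" using r R by auto
  have cancel: "q * s l = r * k" if l: "l \<in> L - {0}" and eq: "3 * (l * (3 ^ \<beta> * q)) = R * k" for l q k
  proof -
    have "(3::int) ^ \<alpha> = 3 ^ ((\<alpha> - 1 - \<beta>) + \<beta> + 1)" using \<alpha>\<beta> by simp
    then have pw: "(3::int) ^ \<alpha> = 3 ^ (\<alpha> - 1 - \<beta>) * 3 ^ \<beta> * 3" by (simp only: power_add power_one_right)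
    have "3 ^ \<alpha> * (q * s l) = 3 * ((3 ^ (\<alpha> - 1 - \<beta>) * s l) * (3 ^ \<beta> * q))"
      unfolding pw by (simp only: mult_ac)
    also have "\<dots> = R * k" using eq s(1)[OF l] by simp
    also have "\<dots> = 3 ^ \<alpha> * (r * k)" by (simp add: r(1))
    finally show ?thesis by simp
  qed
  have dv: "r dvd q1 * s l" "r dvd q2 * s l" if l: "l \<in> L - {0}" for l
    using thirds[OF l] cancel[OF l] q1(1) q2(1) by (metis dvd_triv_left)+
  have ne: "q1 mod 3 \<noteq> q2 mod 3"
  proof
    assume "q1 mod 3 = q2 mod 3"
    then have d: "3 dvd q1 - q2" by (simp add: mod_eq_dvd_iff)
    obtain k1 k2 where k: "3 * (l0 * b1) = R * k1" "3 * (l0 * b2) = R * k2" "\<not> 3 dvd k1" "3 dvd k1 + k2"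
      using thirds[OF l0] by blast
    have "q1 * s l0 = r * k1" "q2 * s l0 = r * k2"
      using cancel[OF l0] k q1 q2 by auto
    then have "r * (k1 - k2) = (q1 - q2) * s l0" by (simp add: algebra_simps)
    then have "3 dvd r * (k1 - k2)" using d by simp
    then have "3 dvd k1 - k2" using r(2) p3 by (simp add: prime_elem_dvd_mult_iff)
    \<comment> \<open>The sum is 2 * k1, while k1 is prime to 3.\<close>
    with k(4) have "3 dvd (k1 + k2) + (k1 - k2)" by (rule dvd_add)
    with k(3) show False by presburger
  qed
  define z where "z = unit_exp (of_int (r * q1) / 3)"
  have "\<not> 3 dvd r * q1" using r(2) q1(2) p3 by (simp add: prime_elem_dvd_mult_iff)
  then have z: "z\<^sup>2 + z + 1 = 0" unfolding z_def by (rule unit_exp_third_root)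
  \<comment> \<open>The single Gram entry of the columns b1 and 0 determines both weight sums, by
    \<open>weights_eq_1_of_cube_root\<close>.\<close>
  have "(\<Sum>l\<in>L. of_real ((cmod (a l))\<^sup>2) * unit_exp (of_int (l * (b1 - 0)) / of_int R))
      = (if b1 = 0 then 3 else 0)"
    by (rule orth[unfolded orthogonal_columns_def, rule_format]) simp_all
  then have "(\<Sum>l\<in>L. of_real ((cmod (a l))\<^sup>2) * unit_exp (of_int (l * (3 ^ \<beta> * q1)) / of_int R)) = 0"
    using B(1) by (simp only: if_False q1(1) diff_zero)
  also have "(\<Sum>l\<in>L. of_real ((cmod (a l))\<^sup>2) * unit_exp (of_int (l * (3 ^ \<beta> * q1)) / of_int R))
    = 1 + of_real (\<Sum>l\<in>{l\<in>L - {0}. s l mod 3 = 1}. (cmod (a l))\<^sup>2) * z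
        + of_real (\<Sum>l\<in>{l\<in>L - {0}. s l mod 3 = 2}. (cmod (a l))\<^sup>2) * z\<^sup>2"
    unfolding z_def
    by (rule weighted_sum_unit_exp[where a = a, OF L a(2) \<alpha>\<beta>(1) r(1) r0 \<alpha>\<beta>(2) r(2)]) (use s dv in blast)
  finally have "1 + of_real (\<Sum>l\<in>{l\<in>L - {0}. s l mod 3 = 1}. (cmod (a l))\<^sup>2) * z
        + of_real (\<Sum>l\<in>{l\<in>L - {0}. s l mod 3 = 2}. (cmod (a l))\<^sup>2) * z\<^sup>2 = 0" .
  note PQ = weights_eq_1_of_cube_root[OF z this]
  show ?thesis
    by (rule exI[of _ \<alpha>], rule exI[of _ r], rule exI[of _ \<beta>], rule exI[of _ q1], rule exI[of _ q2], rule exI[of _ s])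
      (intro conjI ballI \<alpha>\<beta> r q1 q2 ne s dv PQ)
qed

text \<open>Every nonzero difference of two elements of B is 3^beta times an integer q prime to 3,
  because q1 and q2 are incongruent modulo 3; the weight conditions turn its Gram entry into 1 + z +
  z^2 with z a primitive cube root of unity.\<close>

lemma factorisation_imp_orthogonal_columns:
  fixes R b1 b2 :: int and L :: "int set" and a :: "int \<Rightarrow> complex"
  assumes R: "R \<noteq> 0"
    and L: "finite L" "0 \<in> L" and a: "a 0 = 1"
    and st: "1 \<le> \<alpha>" "R = 3 ^ \<alpha> * r" "\<not> 3 dvd r" "b1 = 3 ^ \<beta> * q1" "b2 = 3 ^ \<beta> * q2" "\<beta> \<le> \<alpha> - 1"
      "\<not> 3 dvd q1" "\<not> 3 dvd q2" "q1 mod 3 \<noteq> q2 mod 3"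
    and s: "\<forall>l\<in>L - {0}. l = 3 ^ (\<alpha> - 1 - \<beta>) * s l \<and> \<not> 3 dvd s l \<and> r dvd q1 * s l \<and> r dvd q2 * s l"
    and PQ: "(\<Sum>l\<in>{l\<in>L - {0}. s l mod 3 = 1}. (cmod (a l))\<^sup>2) = 1"
      "(\<Sum>l\<in>{l\<in>L - {0}. s l mod 3 = 2}. (cmod (a l))\<^sup>2) = 1"
  shows "orthogonal_columns R {0, b1, b2} L a"
proof -
  let ?S = "\<lambda>d. \<Sum>l\<in>L. of_real ((cmod (a l))\<^sup>2) * unit_exp (of_int (l * d) / of_int R)"
  have r0: "r \<noteq> 0" using R st by auto
  have S: "?S (3 ^ \<beta> * q) = 1 + unit_exp (of_int (r * q) / 3) + (unit_exp (of_int (r * q) / 3))\<^sup>2"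
    if "\<And>l. l \<in> L - {0} \<Longrightarrow> r dvd q * s l" for q
  proof -
    have "?S (3 ^ \<beta> * q)
      = 1 + of_real (\<Sum>l\<in>{l\<in>L - {0}. s l mod 3 = 1}. (cmod (a l))\<^sup>2) * unit_exp (of_int (r * q) / 3)
          + of_real (\<Sum>l\<in>{l\<in>L - {0}. s l mod 3 = 2}. (cmod (a l))\<^sup>2) * (unit_exp (of_int (r * q) / 3))\<^sup>2"
      by (rule weighted_sum_unit_exp[where a = a, OF L a st(1,2) r0 st(6,3)]) (use s that in blast)
    then show ?thesis unfolding PQ by simp
  qed
  have off: "?S (3 ^ \<beta> * q) = 0" if "\<not> 3 dvd q" "\<And>l. l \<in> L - {0} \<Longrightarrow> r dvd q * s l" for q
  proof -
    have "\<not> 3 dvd r * q" using st(3) that(1) by (simp add: prime_elem_dvd_mult_iff)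
    note z = unit_exp_third_root(1)[OF this]
    show ?thesis by (subst S[OF that(2)], assumption) (use z in \<open>simp only: add_ac\<close>)
  qed
  have diag: "?S 0 = 3" using S[of 0] by simp
  have n: "\<not> 3 dvd q1 - q2" "\<not> 3 dvd q2 - q1" using st(9) by (simp_all add: mod_eq_dvd_iff dvd_diff_commute)
  have d: "r dvd q1 * s l" "r dvd q2 * s l" "r dvd (q1 - q2) * s l" "r dvd (q2 - q1) * s l"
    "r dvd (- q1) * s l" "r dvd (- q2) * s l" if "l \<in> L - {0}" for l
    using s that by (auto simp: left_diff_distrib)
  have "?S (3 ^ \<beta> * q1) = 0" "?S (3 ^ \<beta> * q2) = 0" "?S (3 ^ \<beta> * (- q1)) = 0" "?S (3 ^ \<beta> * (- q2)) = 0"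
    "?S (3 ^ \<beta> * (q1 - q2)) = 0" "?S (3 ^ \<beta> * (q2 - q1)) = 0"
    by (rule off; use st n d in simp)+
  then have "?S b1 = 0" "?S b2 = 0" "?S (- b1) = 0" "?S (- b2) = 0" "?S (b1 - b2) = 0" "?S (b2 - b1) = 0"
    by (simp_all only: st(4,5) right_diff_distrib mult_minus_right)
  note S0 = this
  show ?thesis
    unfolding orthogonal_columns_def
  proof (intro ballI)
    fix c c' assume "c \<in> {0, b1, b2}" "c' \<in> {0, b1, b2}"
    then have "c = c' \<or> c - c' \<in> {b1, b2, - b1, - b2, b1 - b2, b2 - b1}" by auto
    then consider "c = c'" | "c \<noteq> c'" "c - c' \<in> {b1, b2, - b1, - b2, b1 - b2, b2 - b1}" by blast
    then show "?S (c - c') = (if c = c' then 3 else 0)"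
    proof cases
      case 1
      then show ?thesis by (simp only: diff_self simp_thms if_True diag)
    next
      case 2
      from 2(2) have "?S (c - c') = 0" by (elim insertE emptyE) (simp_all only: S0)
      with 2(1) show ?thesis by (simp only: if_False)
    qed
  qed
qed

section \<open>Self-similar measures\<close>

text \<open>In probabilistic terms, mu is the law of (x + c)/R for c uniform on B and an independent
  x with law mu. This form makes change of variables and Fubini available.\<close>

lemma self_similar_measure_eq_distr:
  assumes "self_similar_measure R B \<mu>" "card B = 3"
  shows "\<mu> = distr (measure_pmf (pmf_of_set B) \<Otimes>\<^sub>M \<mu>) borel (\<lambda>(c, x). (x + of_int c) / of_int R)"
proof -
  interpret prob_space \<mu> using assms by (simp add: self_similar_measure_def)
  have sets [measurable_cong]: "sets \<mu> = sets borel" using assms by (simp add: self_similar_measure_def)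
  have sp: "space \<mu> = UNIV" using sets_eq_imp_space_eq[OF sets] by simp
  have fin: "finite B" "B \<noteq> {}" using assms(2) by (auto intro: card_ge_0_finite)
  let ?g = "\<lambda>(c::int, x). (x + of_int c) / of_int R :: real"
  have meas: "?g \<in> (measure_pmf (pmf_of_set B) \<Otimes>\<^sub>M \<mu>) \<rightarrow>\<^sub>M borel" by measurable
  show ?thesis
  proof (rule measure_eqI)
    show "sets \<mu> = sets (distr (measure_pmf (pmf_of_set B) \<Otimes>\<^sub>M \<mu>) borel ?g)" by (simp add: sets)
    fix E assume "E \<in> sets \<mu>"
    then have E: "E \<in> sets borel" by (simp add: sets)
    let ?P = "\<lambda>c. (\<lambda>x. (x + of_int c) / of_int R) -` E"
    have "emeasure (distr (measure_pmf (pmf_of_set B) \<Otimes>\<^sub>M \<mu>) borel ?g) E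
        = emeasure (measure_pmf (pmf_of_set B) \<Otimes>\<^sub>M \<mu>) (?g -` E \<inter> space (measure_pmf (pmf_of_set B) \<Otimes>\<^sub>M \<mu>))"
      using E meas by (rule_tac emeasure_distr) auto
    also have "\<dots> = (\<integral>\<^sup>+ c. emeasure \<mu> (Pair c -` (?g -` E \<inter> space (measure_pmf (pmf_of_set B) \<Otimes>\<^sub>M \<mu>))) \<partial>measure_pmf (pmf_of_set B))"
      using E meas by (intro emeasure_pair_measure_alt measurable_sets[OF meas]) auto
    also have "\<dots> = (\<integral>\<^sup>+ c. emeasure \<mu> (?P c) \<partial>measure_pmf (pmf_of_set B))"
      by (intro nn_integral_cong arg_cong[where f="emeasure \<mu>"]) (auto simp: space_pair_measure sp)
    also have "\<dots> = (\<integral>\<^sup>+ c. ennreal (measure \<mu> (?P c)) \<partial>measure_pmf (pmf_of_set B))"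
      by (simp add: emeasure_eq_measure)
    also have "\<dots> = (\<Sum>c\<in>B. ennreal (measure \<mu> (?P c))) / 3"
      using fin assms(2) by (simp add: nn_integral_pmf_of_set)
    also have "\<dots> = ennreal ((\<Sum>c\<in>B. measure \<mu> (?P c)) / 3)"
      by (simp add: sum_ennreal sum_nonneg divide_ennreal flip: ennreal_numeral)
    also have "(\<Sum>c\<in>B. measure \<mu> (?P c)) / 3 = measure \<mu> E"
      using assms(1) E by (simp add: self_similar_measure_def)
    finally show "emeasure \<mu> E = emeasure (distr (measure_pmf (pmf_of_set B) \<Otimes>\<^sub>M \<mu>) borel ?g) E"
      by (simp add: emeasure_eq_measure)
  qed
qed

lemma self_similar_measure_integral:
  fixes f :: "real \<Rightarrow> 'b::{banach, second_countable_topology}"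
  assumes "self_similar_measure R B \<mu>" "card B = 3" "integrable \<mu> f"
  shows "\<And>c. c \<in> B \<Longrightarrow> integrable \<mu> (\<lambda>x. f ((x + of_int c) / of_int R))"
    and "integral\<^sup>L \<mu> f = (1/3) *\<^sub>R (\<Sum>c\<in>B. LINT x|\<mu>. f ((x + of_int c) / of_int R))"
proof -
  interpret prob_space \<mu> using assms by (simp add: self_similar_measure_def)
  have sets [measurable_cong]: "sets \<mu> = sets borel" using assms by (simp add: self_similar_measure_def)
  have fin: "finite B" "B \<noteq> {}" using assms(2) by (auto intro: card_ge_0_finite)
  let ?p = "measure_pmf (pmf_of_set B)"
  interpret p: pair_prob_space ?p \<mu> ..
  let ?g = "\<lambda>(c::int, x). (x + of_int c) / of_int R :: real"
  have meas: "?g \<in> (?p \<Otimes>\<^sub>M \<mu>) \<rightarrow>\<^sub>M borel" by measurable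
  have eq: "\<mu> = distr (?p \<Otimes>\<^sub>M \<mu>) borel ?g"
    by (rule self_similar_measure_eq_distr[OF assms(1,2)])
  have fm: "f \<in> borel_measurable borel" using assms(3) by (auto dest: borel_measurable_integrable)
  have "integrable (distr (?p \<Otimes>\<^sub>M \<mu>) borel ?g) f" using assms(3) eq by simp
  then have int: "integrable (?p \<Otimes>\<^sub>M \<mu>) (\<lambda>(c, x). f ((x + of_int c) / of_int R))"
    by (subst (asm) integrable_distr_eq[OF meas fm]) (simp add: case_prod_unfold)
  \<comment> \<open>Every c in B has positive mass, so an almost sure statement about c holds for
    each of them.\<close>
  show "integrable \<mu> (\<lambda>x. f ((x + of_int c) / of_int R))" if "c \<in> B" for c
    using p.AE_integrable_fst'[OF int] that fin by (simp add: AE_measure_pmf_iff)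
  have "integral\<^sup>L \<mu> f = integral\<^sup>L (distr (?p \<Otimes>\<^sub>M \<mu>) borel ?g) f" using eq by simp
  also have "\<dots> = (LINT z|(?p \<Otimes>\<^sub>M \<mu>). (case z of (c, x) \<Rightarrow> f ((x + of_int c) / of_int R)))"
    by (subst integral_distr[OF meas fm]) (simp add: case_prod_unfold)
  also have "\<dots> = (LINT c|?p. LINT x|\<mu>. f ((x + of_int c) / of_int R))"
    using p.integral_fst'[OF int] by simp
  also have "\<dots> = (\<Sum>c\<in>B. pmf (pmf_of_set B) c *\<^sub>R (LINT x|\<mu>. f ((x + of_int c) / of_int R)))"
    using fin by (intro integral_measure_pmf) auto
  also have "\<dots> = (1/3) *\<^sub>R (\<Sum>c\<in>B. LINT x|\<mu>. f ((x + of_int c) / of_int R))"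
    using fin assms(2) by (simp add: scaleR_sum_right)
  finally show "integral\<^sup>L \<mu> f = (1/3) *\<^sub>R (\<Sum>c\<in>B. LINT x|\<mu>. f ((x + of_int c) / of_int R))" .
qed

text \<open>Let phi(s) be the mass of |x| > s and C a bound for |c|, c in B. If |(x + c)/R| > C + u,
  then |x| > 2(C + u) - C = C + 2u, so self-similarity gives phi(C + u) <= phi(C + 2u). Iterating
  from u = 1 bounds phi(C + 1) by the limit of phi at infinity, which is 0.\<close>

lemma self_similar_measure_bounded_support:
  assumes mu: "self_similar_measure R B \<mu>" and "card B = 3" and R: "\<bar>R\<bar> \<ge> 2"
  shows "\<exists>K. AE x in \<mu>. \<bar>x\<bar> \<le> K"
proof -
  interpret prob_space \<mu> using assms by (simp add: self_similar_measure_def)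
  have sets [measurable_cong]: "sets \<mu> = sets borel" using assms by (simp add: self_similar_measure_def)
  have sp: "space \<mu> = UNIV" using sets_eq_imp_space_eq[OF sets] by simp
  have fin: "finite B" "B \<noteq> {}" using assms(2) by (auto intro: card_ge_0_finite)
  define C where "C = real_of_int (\<Sum>c\<in>B. \<bar>c\<bar>)"
  have C: "\<bar>real_of_int c\<bar> \<le> C" if "c \<in> B" for c
  proof -
    have "\<bar>c\<bar> \<le> (\<Sum>c\<in>B. \<bar>c\<bar>)" using fin that by (intro member_le_sum) auto
    then show ?thesis unfolding C_def by linarith
  qed
  define \<phi> where "\<phi> s = measure \<mu> {x. \<bar>x\<bar> > s}" for s
  have step: "\<phi> (C + u) \<le> \<phi> (C + 2 * u)" if "u \<ge> 0" for u
  proof -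
    have "measure \<mu> ((\<lambda>x. (x + of_int c) / of_int R) -` {x. \<bar>x\<bar> > C + u}) \<le> \<phi> (C + 2 * u)" if c: "c \<in> B" for c
      unfolding \<phi>_def
    proof (rule finite_measure_mono)
      show "(\<lambda>x. (x + of_int c) / of_int R) -` {x. \<bar>x\<bar> > C + u} \<subseteq> {x. \<bar>x\<bar> > C + 2 * u}"
      proof safe
        fix x :: real assume "\<bar>(x + of_int c) / of_int R\<bar> > C + u"
        then have *: "(C + u) * \<bar>of_int R\<bar> < \<bar>x + of_int c\<bar>"
          using R by (simp add: abs_divide pos_less_divide_eq)
        have "C \<ge> 0" by (simp add: C_def sum_nonneg)
        then have "(C + u) * 2 \<le> (C + u) * \<bar>of_int R\<bar>"
          using R \<open>u \<ge> 0\<close> by (intro mult_left_mono) linarith+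
        then have "2 * C + 2 * u < \<bar>x + of_int c\<bar>" using * by (simp add: algebra_simps)
        with C[OF c] show "\<bar>x\<bar> > C + 2 * u" by linarith
      qed
      have "{x::real. \<bar>x\<bar> > C + 2 * u} \<in> sets borel" by measurable
      then show "{x::real. \<bar>x\<bar> > C + 2 * u} \<in> events" by (simp only: sets)
    qed
    then have "(\<Sum>c\<in>B. measure \<mu> ((\<lambda>x. (x + of_int c) / of_int R) -` {x. \<bar>x\<bar> > C + u})) \<le> 3 * \<phi> (C + 2 * u)"
      using sum_bounded_above[of B "\<lambda>c. measure \<mu> ((\<lambda>x. (x + of_int c) / of_int R) -` {x. \<bar>x\<bar> > C + u})"]
      by (simp add: assms(2))
    moreover have "{x. \<bar>x\<bar> > C + u} \<in> sets borel" by measurable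
    then have "\<phi> (C + u) = (1/3) * (\<Sum>c\<in>B. measure \<mu> ((\<lambda>x. (x + of_int c) / of_int R) -` {x. \<bar>x\<bar> > C + u}))"
      using mu unfolding \<phi>_def self_similar_measure_def by blast
    ultimately show ?thesis by simp
  qed
  have iter: "\<phi> (C + 1) \<le> \<phi> (C + 2 ^ n)" for n
  proof (induction n)
    case (Suc n)
    with step[of "2 ^ n"] show ?case by simp
  qed simp
  have "(\<lambda>n. \<phi> (C + 2 ^ n)) \<longlonglongrightarrow> measure \<mu> (\<Inter>n. {x. \<bar>x\<bar> > C + 2 ^ n})"
    unfolding \<phi>_def
  proof (rule finite_Lim_measure_decseq)
    have "{x::real. \<bar>x\<bar> > s} \<in> sets borel" for s by measurable
    then show "range (\<lambda>n. {x. \<bar>x\<bar> > C + 2 ^ n}) \<subseteq> events" by (auto simp: sets)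
    have "C + 2 ^ m \<le> C + 2 ^ n" if "m \<le> n" for m n :: nat using that by (simp add: power_increasing)
    then show "decseq (\<lambda>n. {x. \<bar>x\<bar> > C + 2 ^ n})"
      unfolding decseq_def by (smt (verit) Collect_mono)
  qed
  also have "(\<Inter>n::nat. {x. \<bar>x\<bar> > C + 2 ^ n}) = {}"
  proof -
    have "\<exists>n. \<not> \<bar>x\<bar> > C + 2 ^ n" for x :: real
    proof -
      obtain n where "\<bar>x\<bar> - C < 2 ^ n" using real_arch_pow[of 2 "\<bar>x\<bar> - C"] by auto
      then show ?thesis by (intro exI[of _ n]) linarith
    qed
    then show ?thesis by blast
  qed
  finally have "(\<lambda>n. \<phi> (C + 2 ^ n)) \<longlonglongrightarrow> 0" by simp
  then have "\<phi> (C + 1) \<le> 0" by (rule LIMSEQ_le_const) (use iter in auto)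
  then have 0: "measure \<mu> {x. \<bar>x\<bar> > C + 1} = 0"
    unfolding \<phi>_def by (simp add: measure_le_0_iff)
  have "{x::real. \<bar>x\<bar> > C + 1} \<in> sets borel" by measurable
  then have "{x. \<bar>x\<bar> > C + 1} \<in> null_sets \<mu>"
    using 0 by (intro null_setsI) (auto simp: emeasure_eq_measure sets)
  then have "AE x in \<mu>. x \<notin> {x. \<bar>x\<bar> > C + 1}" by (rule AE_not_in)
  then have "AE x in \<mu>. \<bar>x\<bar> \<le> C + 1" by (rule AE_mp) (auto simp: not_less)
  then show ?thesis by blast
qed

section \<open>Bessel defects of the word system\<close>

definition square_integrable :: "'a measure \<Rightarrow> ('a \<Rightarrow> complex) \<Rightarrow> bool" where
  "square_integrable M f \<longleftrightarrow> f \<in> borel_measurable M \<and> integrable M (\<lambda>x. (norm (f x))\<^sup>2)"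

definition sq_norm :: "'a measure \<Rightarrow> ('a \<Rightarrow> complex) \<Rightarrow> real" where
  "sq_norm M f = (LINT x|M. (norm (f x))\<^sup>2)"

lemma complex_parallelogram:
  "(norm (x + y))\<^sup>2 + (norm (x - y))\<^sup>2 = 2 * (norm x)\<^sup>2 + 2 * (norm (y::complex))\<^sup>2"
  by (simp only: cmod_power2 plus_complex.simps minus_complex.simps) (simp add: power2_eq_square algebra_simps)

lemma norm_add_square_le: "(norm (x + y))\<^sup>2 \<le> 2 * (norm x)\<^sup>2 + 2 * (norm (y::complex))\<^sup>2"
  using complex_parallelogram[of x y] zero_le_power2[of "norm (x - y)"] by linarith

lemma square_integrable_bound:
  assumes "f \<in> borel_measurable M" "square_integrable M g" "AE x in M. norm (f x) \<le> norm (g x)"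
  shows "square_integrable M f"
  unfolding square_integrable_def
proof
  show "integrable M (\<lambda>x. (norm (f x))\<^sup>2)"
  proof (rule Bochner_Integration.integrable_bound)
    show "integrable M (\<lambda>x. (norm (g x))\<^sup>2)" using assms(2) by (simp add: square_integrable_def)
    show "AE x in M. norm ((norm (f x))\<^sup>2) \<le> norm ((norm (g x))\<^sup>2)"
      using assms(3) by eventually_elim (simp add: power_mono)
  qed (use assms(1) in measurable)
qed (use assms in auto)

lemma square_integrable_add:
  assumes "square_integrable M f" "square_integrable M g"
  shows "square_integrable M (\<lambda>x. f x + g x)"
  unfolding square_integrable_def
proof
  have [measurable]: "f \<in> borel_measurable M" "g \<in> borel_measurable M"
    using assms by (auto simp: square_integrable_def)
  show "(\<lambda>x. f x + g x) \<in> borel_measurable M" by measurable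
  show "integrable M (\<lambda>x. (norm (f x + g x))\<^sup>2)"
  proof (rule Bochner_Integration.integrable_bound)
    show "integrable M (\<lambda>x. 2 * (norm (f x))\<^sup>2 + 2 * (norm (g x))\<^sup>2)"
      using assms by (auto simp: square_integrable_def)
    show "AE x in M. norm ((norm (f x + g x))\<^sup>2) \<le> norm (2 * (norm (f x))\<^sup>2 + 2 * (norm (g x))\<^sup>2)"
      using norm_add_square_le by (intro AE_I2) simp
  qed measurable
qed

lemma square_integrable_cmult:
  assumes "square_integrable M f"
  shows "square_integrable M (\<lambda>x. c * f x)"
  using assms by (auto simp: square_integrable_def norm_mult power_mult_distrib)

lemma square_integrable_diff:
  assumes "square_integrable M f" "square_integrable M g"
  shows "square_integrable M (\<lambda>x. f x - g x)"
  using square_integrable_add[OF assms(1) square_integrable_cmult[OF assms(2), of "-1"]] by simp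

lemma square_integrable_sum:
  assumes "finite I" "\<And>i. i \<in> I \<Longrightarrow> square_integrable M (f i)"
  shows "square_integrable M (\<lambda>x. \<Sum>i\<in>I. f i x)"
  using assms
proof (induction I rule: finite_induct)
  case empty
  show ?case by (simp add: square_integrable_def)
next
  case (insert i I)
  then show ?case by (simp add: square_integrable_add)
qed

lemma (in prob_space) square_integrable_imp_integrable:
  assumes "square_integrable M f"
  shows "integrable M f"
proof (rule Bochner_Integration.integrable_bound)
  show "integrable M (\<lambda>x. 1 + (norm (f x))\<^sup>2)"
    using assms by (auto simp: square_integrable_def)
  show "f \<in> borel_measurable M" using assms by (auto simp: square_integrable_def)
  have "norm (f x) \<le> 1 + (norm (f x))\<^sup>2" for x
    using zero_le_power2[of "norm (f x) - 1/2"] by (simp add: power2_eq_square algebra_simps)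
  then show "AE x in M. norm (f x) \<le> norm (1 + (norm (f x))\<^sup>2)" by (intro AE_I2) simp
qed

text \<open>Cauchy-Schwarz against the constant 1, obtained from the nonnegativity of the variance
  of |f|. It is Bessel's inequality for the empty word.\<close>

lemma (in prob_space) norm_integral_square_le:
  assumes "square_integrable M f"
  shows "(norm (LINT x|M. f x))\<^sup>2 \<le> sq_norm M f"
proof -
  have int: "integrable M (\<lambda>x. norm (f x))"
    using square_integrable_imp_integrable[OF assms] by simp
  have "0 \<le> variance (\<lambda>x. norm (f x))" by (rule variance_positive)
  also have "\<dots> = sq_norm M f - (LINT x|M. norm (f x))\<^sup>2"
    using assms int by (subst variance_eq) (auto simp: square_integrable_def sq_norm_def)
  finally have "(LINT x|M. norm (f x))\<^sup>2 \<le> sq_norm M f" by simp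
  moreover have "(norm (LINT x|M. f x))\<^sup>2 \<le> (LINT x|M. norm (f x))\<^sup>2"
    by (intro power_mono integral_norm_bound) simp
  ultimately show ?thesis by linarith
qed

lemma word_freq_Cons: "word_freq R (l # w) = l + R * word_freq R w"
  unfolding word_freq_def by (simp add: sum.lessThan_Suc_shift sum_distrib_left mult_ac del: sum.lessThan_Suc)

lemma word_coeff_Cons: "word_coeff a (l # w) = a l * word_coeff a w"
  unfolding word_coeff_def by (simp add: prod.lessThan_Suc_shift del: prod.lessThan_Suc)

lemma word_freq_Nil [simp]: "word_freq R [] = 0" and word_coeff_Nil [simp]: "word_coeff a [] = 1"
  by (simp_all add: word_freq_def word_coeff_def)

section \<open>Transfer operators and the energy captured by words\<close>

locale weighted_fourier_system =
  fixes R :: int and B L :: "int set" and a :: "int \<Rightarrow> complex" and \<mu> :: "real measure"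
  assumes abs_R_ge_2: "\<bar>R\<bar> \<ge> 2"
    and card_B: "card B = 3"
    and finite_L: "finite L" and zero_in_L: "0 \<in> L" and a_0: "a 0 = 1"
    and self_similar: "self_similar_measure R B \<mu>"
    and orth: "orthogonal_columns R B L a"
begin

sublocale prob_space \<mu>
  using self_similar by (simp add: self_similar_measure_def)

lemma sets_mu [measurable_cong, simp]: "sets \<mu> = sets borel"
  using self_similar by (simp add: self_similar_measure_def)

lemma space_mu [simp]: "space \<mu> = UNIV"
  using sets_eq_imp_space_eq[OF sets_mu] by simp

lemma finite_B: "finite B"
  using card_B by (auto intro: card_ge_0_finite)

lemma R_nonzero [simp]: "R \<noteq> 0"
  using abs_R_ge_2 by auto

definition coefficient :: "(real \<Rightarrow> complex) \<Rightarrow> int list \<Rightarrow> complex" where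
  "coefficient f w = (LINT x|\<mu>. f x * cnj (word_coeff a w * expo (of_int (word_freq R w)) x))"

text \<open>The operator T_l, chosen so that <f, e_(l + R lam)> = <T_l f, e_lam> for integers lam:
  substitute (x + c)/R in each branch of the self-similarity and pull out e_lam(x + c), which equals
  e_lam(x).\<close>

definition transfer :: "int \<Rightarrow> (real \<Rightarrow> complex) \<Rightarrow> real \<Rightarrow> complex" where
  "transfer l f x = unit_exp (- (of_int l / of_int R * x)) / 3 *
     (\<Sum>c\<in>B. unit_exp (- of_int (l * c) / of_int R) * f ((x + of_int c) / of_int R))"

lemma continuous_on_imp_measurable_mu:
  "continuous_on UNIV (f :: real \<Rightarrow> complex) \<Longrightarrow> f \<in> borel_measurable \<mu>"
  by (simp add: borel_measurable_continuous_onI cong: measurable_cong_sets)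

lemma square_integrable_mult_unimodular:
  assumes "square_integrable \<mu> f" "continuous_on UNIV g" "\<And>x. norm (g x) = r"
  shows "square_integrable \<mu> (\<lambda>x. g x * f x)"
  using assms continuous_on_imp_measurable_mu[OF assms(2)]
  by (auto simp: square_integrable_def norm_mult power_mult_distrib)

lemma continuous_on_expo: "continuous_on UNIV (expo t)"
  unfolding expo_eq_unit_exp by (intro continuous_intros)

lemma norm_expo [simp]: "norm (expo t x) = 1"
  by (simp add: expo_eq_unit_exp)

lemma square_integrable_compose:
  assumes "square_integrable \<mu> f" "c \<in> B"
  shows "square_integrable \<mu> (\<lambda>x. f ((x + of_int c) / of_int R))"
proof -
  have [measurable]: "f \<in> borel_measurable borel"
    using assms by (simp add: square_integrable_def cong: measurable_cong_sets)
  have "integrable \<mu> (\<lambda>x. (norm (f x))\<^sup>2)" using assms by (simp add: square_integrable_def)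
  from self_similar_measure_integral(1)[OF self_similar card_B this assms(2)]
  show ?thesis by (simp add: square_integrable_def)
qed

lemma square_integrable_transfer:
  assumes "square_integrable \<mu> f"
  shows "square_integrable \<mu> (transfer l f)"
  unfolding transfer_def
proof (rule square_integrable_mult_unimodular)
  show "square_integrable \<mu> (\<lambda>x. \<Sum>c\<in>B. unit_exp (- of_int (l * c) / of_int R) * f ((x + of_int c) / of_int R))"
    by (intro square_integrable_sum square_integrable_cmult square_integrable_compose assms finite_B)
  show "continuous_on UNIV (\<lambda>x. unit_exp (- (of_int l / of_int R * x)) / 3)"
    by (intro continuous_intros) auto
  show "norm (unit_exp (- (of_int l / of_int R * x)) / 3) = 1/3" for x
    by (simp add: norm_divide)
qed

text \<open>For fixed x the isometry is applied to the vector of the values f((x + c)/R), c in B,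
  with total factor (1/9) * 3 = 1/3; integrating and using self-similarity gives the squared norm of
  f.\<close>

lemma sum_sq_norm_transfer:
  assumes "square_integrable \<mu> f"
  shows "(\<Sum>l\<in>L. (norm (a l))\<^sup>2 * sq_norm \<mu> (transfer l f)) = sq_norm \<mu> f"
proof -
  have "(\<Sum>l\<in>L. (norm (a l))\<^sup>2 * sq_norm \<mu> (transfer l f))
      = (LINT x|\<mu>. (\<Sum>l\<in>L. (norm (a l))\<^sup>2 * (norm (transfer l f x))\<^sup>2))"
    using square_integrable_transfer[OF assms]
    by (subst Bochner_Integration.integral_sum) (auto simp: sq_norm_def square_integrable_def)
  also have "\<dots> = (LINT x|\<mu>. (1/3) * (\<Sum>c\<in>B. (norm (f ((x + of_int c) / of_int R)))\<^sup>2))"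
  proof (rule Bochner_Integration.integral_cong[OF refl])
    fix x
    have "(norm (transfer l f x))\<^sup>2 = (1/9) * (norm (\<Sum>c\<in>B. unit_exp (- of_int (l * c) / of_int R) * f ((x + of_int c) / of_int R)))\<^sup>2" for l
      unfolding transfer_def by (simp add: norm_mult norm_divide power_mult_distrib power_divide)
    then have "(\<Sum>l\<in>L. (norm (a l))\<^sup>2 * (norm (transfer l f x))\<^sup>2)
      = (1/9) * (\<Sum>l\<in>L. (norm (a l))\<^sup>2 * (norm (\<Sum>c\<in>B. unit_exp (- of_int (l * c) / of_int R) * f ((x + of_int c) / of_int R)))\<^sup>2)"
      by (simp only: sum_distrib_left mult_ac)
    also have "\<dots> = (1/9) * (3 * (\<Sum>c\<in>B. (norm (f ((x + of_int c) / of_int R)))\<^sup>2))"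
      by (subst orthogonal_columns_pythagoras[OF orth finite_B]) (rule refl)
    finally show "(\<Sum>l\<in>L. (norm (a l))\<^sup>2 * (norm (transfer l f x))\<^sup>2)
      = (1/3) * (\<Sum>c\<in>B. (norm (f ((x + of_int c) / of_int R)))\<^sup>2)" by simp
  qed
  also have "\<dots> = (1/3) * (\<Sum>c\<in>B. LINT x|\<mu>. (norm (f ((x + of_int c) / of_int R)))\<^sup>2)"
    using square_integrable_compose[OF assms] by (simp add: square_integrable_def)
  also have "\<dots> = sq_norm \<mu> f"
    using self_similar_measure_integral(2)[OF self_similar card_B, of "\<lambda>x. (norm (f x))\<^sup>2"] assms
    by (simp add: sq_norm_def square_integrable_def)
  finally show ?thesis .
qed

lemma square_integrable_coefficient_integrand:
  assumes "square_integrable \<mu> f"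
  shows "square_integrable \<mu> (\<lambda>x. f x * cnj (word_coeff a w * expo (of_int (word_freq R w)) x))"
proof -
  have "square_integrable \<mu> (\<lambda>x. cnj (word_coeff a w * expo (of_int (word_freq R w)) x) * f x)"
    by (rule square_integrable_mult_unimodular[OF assms, of _ "norm (word_coeff a w)"])
      (auto simp: norm_mult intro!: continuous_intros continuous_on_expo simp del: complex_cnj_mult)
  then show ?thesis by (simp only: mult.commute)
qed

lemma integrable_coefficient:
  assumes "square_integrable \<mu> f"
  shows "integrable \<mu> (\<lambda>x. f x * cnj (word_coeff a w * expo (of_int (word_freq R w)) x))"
  by (rule square_integrable_imp_integrable[OF square_integrable_coefficient_integrand[OF assms]])

lemma coefficient_Cons:
  assumes "square_integrable \<mu> f"
  shows "coefficient f (l # w) = cnj (a l) * coefficient (transfer l f) w"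
proof -
  define h where "h x = f x * cnj (word_coeff a (l # w) * expo (of_int (word_freq R (l # w))) x)" for x
  have int: "integrable \<mu> h" unfolding h_def by (rule integrable_coefficient[OF assms])
  note ss = self_similar_measure_integral[OF self_similar card_B int]
  have pt: "h ((x + of_int c) / of_int R)
      = cnj (a l) * cnj (word_coeff a w * expo (of_int (word_freq R w)) x) * unit_exp (- (of_int l / of_int R * x)) *
        (unit_exp (- of_int (l * c) / of_int R) * f ((x + of_int c) / of_int R))" for x c
  proof -
    \<comment> \<open>The last summand is an integer and drops out of the exponential.\<close>
    have "of_int (word_freq R (l # w)) * ((x + of_int c) / of_int R)
        = of_int (word_freq R w) * x + of_int l / of_int R * x + of_int (l * c) / of_int R + of_int (word_freq R w * c)"
      by (simp add: word_freq_Cons field_simps)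
    then have "expo (of_int (word_freq R (l # w))) ((x + of_int c) / of_int R)
        = expo (of_int (word_freq R w)) x * unit_exp (of_int l / of_int R * x) * unit_exp (of_int (l * c) / of_int R)"
      by (simp only: expo_eq_unit_exp unit_exp_add) (simp add: unit_exp_Ints)
    then show ?thesis by (simp add: h_def word_coeff_Cons cnj_unit_exp mult_ac)
  qed
  have "coefficient f (l # w) = (1/3) * (\<Sum>c\<in>B. LINT x|\<mu>. h ((x + of_int c) / of_int R))"
  proof -
    have "coefficient f (l # w) = integral\<^sup>L \<mu> h" by (simp only: coefficient_def h_def[abs_def])
    then show ?thesis by (simp add: ss(2) scaleR_conv_of_real)
  qed
  also have "\<dots> = (LINT x|\<mu>. (1/3) * (\<Sum>c\<in>B. h ((x + of_int c) / of_int R)))"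
    using ss(1) by simp
  also have "\<dots> = (LINT x|\<mu>. cnj (a l) * (transfer l f x * cnj (word_coeff a w * expo (of_int (word_freq R w)) x)))"
    unfolding pt transfer_def sum_distrib_left[symmetric] by (simp add: mult_ac)
  also have "\<dots> = cnj (a l) * coefficient (transfer l f) w"
    unfolding coefficient_def by simp
  finally show ?thesis .
qed

text \<open>The word [0] lies outside \<open>Omega L\<close> but has frequency 0 and weight 1,
  exactly like the empty word; the empty word therefore takes its place in the recursion on the
  first letter.\<close>

lemma coefficient_transfer_Nil:
  assumes "square_integrable \<mu> f"
  shows "coefficient (transfer 0 f) [] = coefficient f []"
proof -
  have "coefficient (transfer 0 f) [] = coefficient f [0]"
    using coefficient_Cons[OF assms, of 0 "[]"] by (simp add: a_0)
  also have "\<dots> = coefficient f []"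
    by (simp add: coefficient_def word_coeff_Cons word_freq_Cons a_0)
  finally show ?thesis .
qed

definition short_words :: "nat \<Rightarrow> int list set" where
  "short_words n = {w \<in> Omega L. length w \<le> n}"

lemma short_words_0: "short_words 0 = {[]}"
  by (auto simp: short_words_def Omega_def)

lemma finite_short_words: "finite (short_words n)"
  by (rule finite_subset[OF _ finite_lists_length_le[OF finite_L, of n]])
    (auto simp: short_words_def Omega_def)

text \<open>Prepending l to w stays inside \<open>Omega L\<close> except for the pair (0, []), since
  [0] ends in 0; that pair is sent to the empty word, which is otherwise missed.\<close>

lemma bij_betw_short_words:
  "bij_betw (\<lambda>(l, w). if l = 0 \<and> w = [] then [] else l # w) (L \<times> short_words n) (short_words (Suc n))"
proof (rule bij_betw_byWitness[where f' = "\<lambda>w. if w = [] then (0, []) else (hd w, tl w)"])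
  show "(\<lambda>(l, w). if l = 0 \<and> w = [] then [] else l # w) ` (L \<times> short_words n) \<subseteq> short_words (Suc n)"
    by (auto simp: short_words_def Omega_def split: if_splits)
  show "(\<lambda>w. if w = [] then (0, []) else (hd w, tl w)) ` short_words (Suc n) \<subseteq> L \<times> short_words n"
  proof (safe, goal_cases)
    case (1 l v w)
    then show ?case by (cases w) (auto simp: short_words_def Omega_def zero_in_L)
  next
    case (2 l v w)
    then show ?case by (cases w) (auto simp: short_words_def Omega_def split: if_splits)
  qed
  show "\<forall>w\<in>short_words (Suc n). (\<lambda>(l, w). if l = 0 \<and> w = [] then [] else l # w) (if w = [] then (0, []) else (hd w, tl w)) = w"
  proof
    fix w assume w: "w \<in> short_words (Suc n)"
    show "(\<lambda>(l, w). if l = 0 \<and> w = [] then [] else l # w) (if w = [] then (0, []) else (hd w, tl w)) = w"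
      using w by (cases w) (auto simp: short_words_def Omega_def)
  qed
qed auto

definition partial_energy :: "nat \<Rightarrow> (real \<Rightarrow> complex) \<Rightarrow> real" where
  "partial_energy n f = (\<Sum>w\<in>short_words n. (norm (coefficient f w))\<^sup>2)"

definition defect :: "nat \<Rightarrow> (real \<Rightarrow> complex) \<Rightarrow> real" where
  "defect n f = sq_norm \<mu> f - partial_energy n f"

lemma partial_energy_Suc:
  assumes "square_integrable \<mu> f"
  shows "partial_energy (Suc n) f = (\<Sum>l\<in>L. (norm (a l))\<^sup>2 * partial_energy n (transfer l f))"
proof -
  have "partial_energy (Suc n) f
      = (\<Sum>(l, w)\<in>L \<times> short_words n. (norm (coefficient f (if l = 0 \<and> w = [] then [] else l # w)))\<^sup>2)"
    unfolding partial_energy_def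
    by (subst sum.reindex_bij_betw[OF bij_betw_short_words, symmetric]) (simp add: case_prod_unfold)
  also have "\<dots> = (\<Sum>(l, w)\<in>L \<times> short_words n. (norm (a l))\<^sup>2 * (norm (coefficient (transfer l f) w))\<^sup>2)"
    using coefficient_transfer_Nil[OF assms]
    by (intro sum.cong refl) (auto simp: coefficient_Cons[OF assms] norm_mult power_mult_distrib a_0)
  also have "\<dots> = (\<Sum>l\<in>L. (norm (a l))\<^sup>2 * partial_energy n (transfer l f))"
    unfolding partial_energy_def by (simp add: sum_distrib_left sum.cartesian_product)
  finally show ?thesis .
qed

text \<open>Norm and energy split over the functions T_l f with the same weights, hence so does
  their difference.\<close>

lemma defect_Suc:
  assumes "square_integrable \<mu> f"
  shows "defect (Suc n) f = (\<Sum>l\<in>L. (norm (a l))\<^sup>2 * defect n (transfer l f))"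
  unfolding defect_def right_diff_distrib sum_subtractf
  by (simp only: partial_energy_Suc[OF assms] sum_sq_norm_transfer[OF assms])

text \<open>Bessel's inequality for words of length at most n, by induction on n with f replaced by
  the functions T_l f.\<close>

lemma defect_nonneg:
  assumes "square_integrable \<mu> f"
  shows "defect n f \<ge> 0"
  using assms
proof (induction n arbitrary: f)
  case 0
  have "partial_energy 0 f = (norm (LINT x|\<mu>. f x))\<^sup>2"
    by (simp add: partial_energy_def short_words_0 coefficient_def expo_eq_unit_exp)
  with norm_integral_square_le[OF 0] show ?case by (simp add: defect_def)
next
  case (Suc n)
  show ?case unfolding defect_Suc[OF Suc.prems]
    by (intro sum_nonneg mult_nonneg_nonneg Suc.IH square_integrable_transfer Suc.prems) auto
qed

lemma defect_le_sq_norm: "defect n f \<le> sq_norm \<mu> f"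
  by (simp add: defect_def partial_energy_def sum_nonneg)

lemma defect_antimono: "defect (Suc n) f \<le> defect n f"
proof -
  have "partial_energy n f \<le> partial_energy (Suc n) f"
    unfolding partial_energy_def by (rule sum_mono2) (auto simp: finite_short_words, auto simp: short_words_def)
  then show ?thesis by (simp add: defect_def)
qed

lemma defect_cmult: "defect n (\<lambda>x. c * f x) = (norm c)\<^sup>2 * defect n f"
proof -
  have "coefficient (\<lambda>x. c * f x) w = c * coefficient f w" for w
    by (simp add: coefficient_def mult.assoc)
  moreover have "sq_norm \<mu> (\<lambda>x. c * f x) = (norm c)\<^sup>2 * sq_norm \<mu> f"
    by (simp add: sq_norm_def norm_mult power_mult_distrib)
  ultimately show ?thesis
    by (simp add: defect_def partial_energy_def norm_mult power_mult_distrib sum_distrib_left right_diff_distrib)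
qed

text \<open>The defect is a quadratic form, built from the squared norm and squared moduli of linear
  functionals. Together with nonnegativity this yields \<open>defect_add_le\<close>, which stands in
  for a triangle inequality.\<close>

lemma defect_parallelogram:
  assumes "square_integrable \<mu> f" "square_integrable \<mu> g"
  shows "defect n (\<lambda>x. f x + g x) + defect n (\<lambda>x. f x - g x) = 2 * defect n f + 2 * defect n g"
proof -
  note int = integrable_coefficient[OF assms(1)] integrable_coefficient[OF assms(2)]
  have c: "coefficient (\<lambda>x. f x + g x) w = coefficient f w + coefficient g w"
      "coefficient (\<lambda>x. f x - g x) w = coefficient f w - coefficient g w" for w
    unfolding coefficient_def distrib_right left_diff_distrib using int by (simp_all del: complex_cnj_mult)
  have "sq_norm \<mu> (\<lambda>x. f x + g x) + sq_norm \<mu> (\<lambda>x. f x - g x)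
      = (LINT x|\<mu>. (norm (f x + g x))\<^sup>2 + (norm (f x - g x))\<^sup>2)"
    unfolding sq_norm_def
    using square_integrable_add[OF assms] square_integrable_diff[OF assms]
    by (intro Bochner_Integration.integral_add[symmetric]) (auto simp: square_integrable_def)
  also have "\<dots> = 2 * sq_norm \<mu> f + 2 * sq_norm \<mu> g"
    unfolding complex_parallelogram using assms by (simp add: square_integrable_def sq_norm_def)
  finally have s: "sq_norm \<mu> (\<lambda>x. f x + g x) + sq_norm \<mu> (\<lambda>x. f x - g x) = 2 * sq_norm \<mu> f + 2 * sq_norm \<mu> g" .
  have "partial_energy n (\<lambda>x. f x + g x) + partial_energy n (\<lambda>x. f x - g x)
      = 2 * partial_energy n f + 2 * partial_energy n g"
    unfolding partial_energy_def c sum.distrib[symmetric] complex_parallelogram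
    by (simp add: sum.distrib sum_distrib_left)
  moreover have "(p - p') + (q - q') = 2 * (u - u') + 2 * (v - v')"
    if "p + q = 2 * u + 2 * v" "p' + q' = 2 * u' + 2 * v'" for p q u v p' q' u' v' :: real
    using that by (simp add: algebra_simps)
  ultimately show ?thesis unfolding defect_def using s by blast
qed

lemma defect_add_le:
  assumes "square_integrable \<mu> f" "square_integrable \<mu> g"
  shows "defect n (\<lambda>x. f x + g x) \<le> 2 * defect n f + 2 * defect n g"
proof -
  have "u \<le> w" if "u + v = w" "0 \<le> v" for u v w :: real using that by simp
  then show ?thesis
    using defect_parallelogram[OF assms] defect_nonneg[OF square_integrable_diff[OF assms]] by blast
qed

section \<open>The closed subspace of functions whose defect tends to 0\<close>

definition reproduced :: "(real \<Rightarrow> complex) \<Rightarrow> bool" where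
  "reproduced f \<longleftrightarrow> square_integrable \<mu> f \<and> (\<lambda>n. defect n f) \<longlonglongrightarrow> 0"

lemma reproduced_add:
  assumes "reproduced f" "reproduced g"
  shows "reproduced (\<lambda>x. f x + g x)"
  unfolding reproduced_def
proof
  have sq: "square_integrable \<mu> f" "square_integrable \<mu> g" using assms by (auto simp: reproduced_def)
  show s: "square_integrable \<mu> (\<lambda>x. f x + g x)" by (rule square_integrable_add[OF sq])
  have "(\<lambda>n. 2 * defect n f + 2 * defect n g) \<longlonglongrightarrow> 2 * 0 + 2 * 0"
    using assms by (intro tendsto_intros) (auto simp: reproduced_def)
  then have "(\<lambda>n. 2 * defect n f + 2 * defect n g) \<longlonglongrightarrow> 0" by simp
  then show "(\<lambda>n. defect n (\<lambda>x. f x + g x)) \<longlonglongrightarrow> 0"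
    by (rule tendsto_sandwich[OF _ _ tendsto_const, rotated 2]) (auto simp: defect_nonneg[OF s] defect_add_le[OF sq])
qed

lemma reproduced_cmult:
  assumes "reproduced f"
  shows "reproduced (\<lambda>x. c * f x)"
  using assms tendsto_mult_left[of "\<lambda>n. defect n f" 0 sequentially "(norm c)\<^sup>2"]
  by (simp add: reproduced_def square_integrable_cmult defect_cmult)

lemma reproduced_diff:
  assumes "reproduced f" "reproduced g"
  shows "reproduced (\<lambda>x. f x - g x)"
  using reproduced_add[OF assms(1) reproduced_cmult[OF assms(2), of "-1"]] by simp

lemma reproduced_zero: "reproduced (\<lambda>x. 0)"
  by (simp add: reproduced_def square_integrable_def defect_def partial_energy_def sq_norm_def coefficient_def)

lemma reproduced_sum:
  assumes "finite I" "\<And>i. i \<in> I \<Longrightarrow> reproduced (f i)"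
  shows "reproduced (\<lambda>x. \<Sum>i\<in>I. f i x)"
  using assms by (induction I rule: finite_induct) (auto simp: reproduced_zero reproduced_add)

lemma reproduced_closed:
  assumes f: "square_integrable \<mu> f"
    and appr: "\<And>e. e > 0 \<Longrightarrow> \<exists>g. reproduced g \<and> sq_norm \<mu> (\<lambda>x. f x - g x) < e"
  shows "reproduced f"
  unfolding reproduced_def
proof
  show "(\<lambda>n. defect n f) \<longlonglongrightarrow> 0"
  proof (rule LIMSEQ_I)
    fix e :: real assume e: "e > 0"
    \<comment> \<open>A quarter, because \<open>defect_add_le\<close> doubles both the approximation
      error and the defect of g.\<close>
    obtain g where g: "reproduced g" "sq_norm \<mu> (\<lambda>x. f x - g x) < e / 4"
      using appr[of "e / 4"] e by auto
    have sg: "square_integrable \<mu> g" using g by (simp add: reproduced_def)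
    obtain n0 where n0: "\<And>n. n \<ge> n0 \<Longrightarrow> \<bar>defect n g\<bar> < e / 4"
      using g(1) LIMSEQ_D[of "\<lambda>n. defect n g" 0 "e / 4"] e by (auto simp: reproduced_def)
    have "norm (defect n f - 0) < e" if "n \<ge> n0" for n
    proof -
      have "defect n f = defect n (\<lambda>x. (f x - g x) + g x)" by simp
      also have "\<dots> \<le> 2 * defect n (\<lambda>x. f x - g x) + 2 * defect n g"
        by (intro defect_add_le square_integrable_diff f sg)
      also have "\<dots> < e"
        using n0[OF that] g(2) defect_le_sq_norm[of n "\<lambda>x. f x - g x"] by linarith
      finally show ?thesis using defect_nonneg[OF f, of n] by simp
    qed
    then show "\<exists>n0. \<forall>n\<ge>n0. norm (defect n f - 0) < e" by blast
  qed
qed (rule f)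

text \<open>Every finite set of words lies in some \<open>short_words n\<close>, so for nonnegative
  terms the unordered sum is the limit of the partial energies.\<close>

lemma reproduced_imp_has_sum:
  assumes "reproduced f"
  shows "((\<lambda>w. (norm (coefficient f w))\<^sup>2) has_sum sq_norm \<mu> f) (Omega L)"
proof -
  let ?t = "\<lambda>w. (norm (coefficient f w))\<^sup>2"
  have f: "square_integrable \<mu> f" using assms by (simp add: reproduced_def)
  have le: "sum ?t F \<le> sq_norm \<mu> f" if "finite F" "F \<subseteq> Omega L" for F
  proof -
    \<comment> \<open>The inserted 0 keeps the maximum defined when F is empty.\<close>
    have "F \<subseteq> short_words (Max (insert 0 (length ` F)))"
      using that by (auto simp: short_words_def intro!: Max_ge)
    then have "sum ?t F \<le> partial_energy (Max (insert 0 (length ` F))) f"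
      unfolding partial_energy_def by (intro sum_mono2 finite_short_words) auto
    also have "\<dots> \<le> sq_norm \<mu> f" using defect_nonneg[OF f] by (simp add: defect_def)
    finally show ?thesis .
  qed
  have sm: "?t summable_on Omega L"
    by (rule nonneg_bdd_above_summable_on) (use le in \<open>auto intro!: bdd_aboveI2[of _ _ "sq_norm \<mu> f"]\<close>)
  have "infsum ?t (Omega L) \<le> sq_norm \<mu> f"
    by (rule infsum_le_finite_sums[OF sm]) (use le in auto)
  moreover have "sq_norm \<mu> f \<le> infsum ?t (Omega L)"
  proof -
    have "(\<lambda>n. sq_norm \<mu> f - defect n f) \<longlonglongrightarrow> sq_norm \<mu> f - 0"
      using assms by (intro tendsto_intros) (auto simp: reproduced_def)
    then have "(\<lambda>n. partial_energy n f) \<longlonglongrightarrow> sq_norm \<mu> f" by (simp add: defect_def)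
    moreover have "partial_energy n f \<le> infsum ?t (Omega L)" for n
      unfolding partial_energy_def
      by (rule finite_sum_le_infsum[OF sm finite_short_words]) (auto simp: short_words_def)
    ultimately show ?thesis by (intro LIMSEQ_le_const2) auto
  qed
  ultimately show ?thesis using has_sum_infsum[OF sm] by simp
qed

end

section \<open>Exponentials are reproduced\<close>

context weighted_fourier_system
begin

text \<open>The characteristic function of the uniform distribution on B. Its value at (t - l)/R is
  the factor with which T_l maps e_t to a multiple of e_((t - l)/R).\<close>

definition mask :: "real \<Rightarrow> complex" where
  "mask x = (\<Sum>c\<in>B. unit_exp (of_int c * x)) / 3"

lemma transfer_expo:
  "transfer l (expo t) = (\<lambda>x. mask ((t - of_int l) / of_int R) * expo ((t - of_int l) / of_int R) x)"
proof
  fix x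
  have "unit_exp (- (of_int l / of_int R * x)) * (unit_exp (- of_int (l * c) / of_int R) * expo t ((x + of_int c) / of_int R))
    = unit_exp (of_int c * ((t - of_int l) / of_int R)) * expo ((t - of_int l) / of_int R) x" for c
    unfolding expo_eq_unit_exp unit_exp_add[symmetric]
    by (rule arg_cong[where f = unit_exp]) (simp add: field_simps)
  then show "transfer l (expo t) x = mask ((t - of_int l) / of_int R) * expo ((t - of_int l) / of_int R) x"
    unfolding transfer_def mask_def by (simp add: sum_distrib_left sum_distrib_right)
qed

lemma square_integrable_expo: "square_integrable \<mu> (expo t)"
  using continuous_on_imp_measurable_mu[OF continuous_on_expo] by (simp add: square_integrable_def)

lemma sq_norm_expo: "sq_norm \<mu> (expo t) = 1"
  using prob_space by (simp add: sq_norm_def)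

text \<open>The energy identity for the functions T_l e_t, where e_t has norm 1. It makes the
  weights in \<open>limit_defect_eq\<close> a probability vector, on which the maximum principle
  rests.\<close>

lemma sum_norm_mask:
  "(\<Sum>l\<in>L. (norm (a l))\<^sup>2 * (norm (mask ((t - of_int l) / of_int R)))\<^sup>2) = 1"
proof -
  have "sq_norm \<mu> (transfer l (expo t)) = (norm (mask ((t - of_int l) / of_int R)))\<^sup>2" for l
    using prob_space by (simp add: transfer_expo sq_norm_def norm_mult)
  then show ?thesis
    using sum_sq_norm_transfer[OF square_integrable_expo, of t] by (simp add: sq_norm_expo)
qed

lemma defect_expo_Suc:
  "defect (Suc n) (expo t) = (\<Sum>l\<in>L. (norm (a l))\<^sup>2 * (norm (mask ((t - of_int l) / of_int R)))\<^sup>2 *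
      defect n (expo ((t - of_int l) / of_int R)))"
  unfolding defect_Suc[OF square_integrable_expo] transfer_expo defect_cmult by (simp add: mult_ac)

text \<open>Only finitely many coefficients enter, and each is continuous in t by dominated
  convergence with a constant bound.\<close>

lemma tendsto_defect_expo:
  assumes "X \<longlonglongrightarrow> t"
  shows "(\<lambda>k. defect n (expo (X k))) \<longlonglongrightarrow> defect n (expo t)"
proof -
  have "(\<lambda>k. coefficient (expo (X k)) w) \<longlonglongrightarrow> coefficient (expo t) w" for w
    unfolding coefficient_def
  proof (rule integral_dominated_convergence[where w = "\<lambda>_. norm (word_coeff a w)"])
    have m: "(\<lambda>x. expo s x * cnj (word_coeff a w * expo (of_int (word_freq R w)) x)) \<in> borel_measurable \<mu>" for s
      using square_integrable_coefficient_integrand[OF square_integrable_expo] by (simp add: square_integrable_def)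
    then show "(\<lambda>x. expo t x * cnj (word_coeff a w * expo (of_int (word_freq R w)) x)) \<in> borel_measurable \<mu>"
      and "\<And>k. (\<lambda>x. expo (X k) x * cnj (word_coeff a w * expo (of_int (word_freq R w)) x)) \<in> borel_measurable \<mu>"
      by blast+
    show "AE x in \<mu>. (\<lambda>k. expo (X k) x * cnj (word_coeff a w * expo (of_int (word_freq R w)) x))
        \<longlonglongrightarrow> expo t x * cnj (word_coeff a w * expo (of_int (word_freq R w)) x)"
    proof (intro AE_I2 tendsto_intros)
      fix x
      show "(\<lambda>k. expo (X k) x) \<longlonglongrightarrow> expo t x"
        unfolding expo_def by (intro tendsto_intros assms)
    qed
  qed (auto simp: norm_mult)
  then show ?thesis
    unfolding defect_def partial_energy_def sq_norm_expo by (intro tendsto_intros)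
qed

text \<open>The function g(t) whose vanishing is to be shown; \<open>lim\<close> is meaningful
  because the defects decrease in n and are nonnegative.\<close>

definition limit_defect :: "real \<Rightarrow> real" where
  "limit_defect t = lim (\<lambda>n. defect n (expo t))"

lemma limit_defect: "(\<lambda>n. defect n (expo t)) \<longlonglongrightarrow> limit_defect t"
  and limit_defect_le: "limit_defect t \<le> defect n (expo t)"
proof -
  have dec: "decseq (\<lambda>n. defect n (expo t))" by (intro decseq_SucI defect_antimono)
  obtain l where "(\<lambda>n. defect n (expo t)) \<longlonglongrightarrow> l"
    using decseq_convergent[OF dec] defect_nonneg[OF square_integrable_expo] by metis
  then show lim: "(\<lambda>n. defect n (expo t)) \<longlonglongrightarrow> limit_defect t"
    unfolding limit_defect_def by (simp add: limI)
  show "limit_defect t \<le> defect n (expo t)" by (rule decseq_ge[OF dec lim])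
qed

lemma limit_defect_nonneg: "limit_defect t \<ge> 0"
  by (rule LIMSEQ_le_const[OF limit_defect]) (use defect_nonneg[OF square_integrable_expo] in blast)

lemma limit_defect_le_1: "limit_defect t \<le> 1"
  using limit_defect_le[of t 0] defect_le_sq_norm[of 0 "expo t"] by (simp add: sq_norm_expo)

text \<open>The empty word is e_0 itself and captures all of its norm.\<close>

lemma limit_defect_0: "limit_defect 0 = 0"
proof -
  have "defect 0 (expo 0) = 0"
    using prob_space
    by (simp add: defect_def partial_energy_def short_words_0 coefficient_def sq_norm_def expo_eq_unit_exp)
  then show ?thesis using limit_defect_le[of 0 0] limit_defect_nonneg[of 0] by simp
qed

lemma limit_defect_eq:
  "limit_defect t = (\<Sum>l\<in>L. (norm (a l))\<^sup>2 * (norm (mask ((t - of_int l) / of_int R)))\<^sup>2 *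
      limit_defect ((t - of_int l) / of_int R))"
proof (rule LIMSEQ_unique)
  show "(\<lambda>n. defect (Suc n) (expo t)) \<longlonglongrightarrow> limit_defect t"
    using limit_defect by (rule LIMSEQ_Suc)
  show "(\<lambda>n. defect (Suc n) (expo t)) \<longlonglongrightarrow> (\<Sum>l\<in>L. (norm (a l))\<^sup>2 * (norm (mask ((t - of_int l) / of_int R)))\<^sup>2 *
      limit_defect ((t - of_int l) / of_int R))"
    unfolding defect_expo_Suc by (intro tendsto_intros limit_defect)
qed

text \<open>A decreasing limit of continuous functions is upper semicontinuous. The sequential form
  fits its two uses: a maximising sequence and a sequence tending to 0.\<close>

lemma limit_defect_upper_semicontinuous:
  assumes "X \<longlonglongrightarrow> t" "(\<lambda>k. limit_defect (X k)) \<longlonglongrightarrow> c"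
  shows "c \<le> limit_defect t"
proof (rule LIMSEQ_le_const[OF limit_defect])
  have "c \<le> defect n (expo t)" for n
    by (rule LIMSEQ_le[OF assms(2) tendsto_defect_expo[OF assms(1)]]) (use limit_defect_le in blast)
  then show "\<exists>N. \<forall>n\<ge>N. c \<le> defect n (expo t)" by blast
qed

lemma limit_defect_attains_max:
  assumes "K \<ge> 0"
  obtains x where "x \<in> {-K..K}" "\<And>y. y \<in> {-K..K} \<Longrightarrow> limit_defect y \<le> limit_defect x"
proof -
  define c where "c = Sup (limit_defect ` {-K..K})"
  have ne: "limit_defect ` {-K..K} \<noteq> {}" using assms by auto
  have bdd: "bdd_above (limit_defect ` {-K..K})" using limit_defect_le_1 by (auto intro!: bdd_aboveI)
  have le: "limit_defect y \<le> c" if "y \<in> {-K..K}" for y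
    unfolding c_def by (rule cSup_upper[OF _ bdd]) (use that in auto)
  have "\<exists>y\<in>{-K..K}. c - inverse (real (Suc k)) < limit_defect y" for k
  proof -
    have "c - inverse (real (Suc k)) < Sup (limit_defect ` {-K..K})"
      unfolding c_def[symmetric] by simp
    then show ?thesis using less_cSupD[OF ne] by blast
  qed
  then obtain X where X: "\<And>k. X k \<in> {-K..K}" "\<And>k. c - inverse (real (Suc k)) < limit_defect (X k)"
    by metis
  obtain x \<sigma> where x: "x \<in> {-K..K}" "strict_mono \<sigma>" "(X \<circ> \<sigma>) \<longlonglongrightarrow> x"
    using compact_imp_seq_compact[OF compact_Icc, of "-K" K] X(1) unfolding seq_compact_def by metis
  have "(\<lambda>k. limit_defect (X k)) \<longlonglongrightarrow> c"
  proof (rule tendsto_sandwich)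
    show "(\<lambda>k. c - inverse (real (Suc k))) \<longlonglongrightarrow> c"
      using tendsto_diff[OF tendsto_const LIMSEQ_inverse_real_of_nat, of c] by simp
    show "\<forall>\<^sub>F k in sequentially. c - inverse (real (Suc k)) \<le> limit_defect (X k)"
      using X(2) by (intro always_eventually allI) (simp add: less_imp_le)
    show "\<forall>\<^sub>F k in sequentially. limit_defect (X k) \<le> c"
      using X(1) le by (intro always_eventually allI) blast
  qed (rule tendsto_const)
  then have "((\<lambda>k. limit_defect (X k)) \<circ> \<sigma>) \<longlonglongrightarrow> c"
    using x(2) by (rule LIMSEQ_subseq_LIMSEQ)
  then have "c \<le> limit_defect x"
    using limit_defect_upper_semicontinuous[OF x(3)] by (simp add: o_def)
  with le x(1) show thesis by (intro that[of x]) (auto intro: order_trans)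
qed

end

text \<open>Condition (v) is recast in terms of roots of unity: \<open>branching\<close> asks that
  each primitive cube root z be the value at b1 of two letters that differ modulo R. Their values at
  b2 then follow from orthogonality to the row 0.\<close>

locale branching_fourier_system = weighted_fourier_system R "{0, b1, b2}" L a \<mu>
  for R b1 b2 :: int and L :: "int set" and a :: "int \<Rightarrow> complex" and \<mu> :: "real measure" +
  assumes b1_nonzero: "b1 \<noteq> 0" and b2_nonzero: "b2 \<noteq> 0" and b1_neq_b2: "b1 \<noteq> b2"
    and a_nonzero: "\<And>l. l \<in> L \<Longrightarrow> a l \<noteq> 0"
    and three_dvd_R: "3 dvd R"
    and branching: "\<And>z. z\<^sup>2 + z + 1 = 0 \<Longrightarrow>
      \<exists>l\<in>L. \<exists>l'\<in>L. unit_exp (of_int (l * b1) / of_int R) = z \<and> unit_exp (of_int (l' * b1) / of_int R) = z \<and>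
        \<not> R dvd l - l'"
begin

lemma mask_eq: "mask x = (1 + unit_exp (of_int b1 * x) + unit_exp (of_int b2 * x)) / 3"
  using b1_nonzero b2_nonzero b1_neq_b2 by (simp add: mask_def add_ac)

text \<open>At a zero of the mask, e(b1 x/R) is a cube root of unity, so 3 b1 x/R is an integer; it
  remains to multiply by the integer R/3.\<close>

lemma mask_zeroD:
  assumes "mask (x / of_int R) = 0"
  shows "of_int b1 * x \<in> \<int>"
proof -
  have "1 + unit_exp (of_int b1 * (x / of_int R)) + unit_exp (of_int b2 * (x / of_int R)) = 0"
    using assms by (simp add: mask_eq)
  then have "unit_exp (of_int b1 * (x / of_int R)) ^ 3 = 1"
    by (intro unit_complex_sum_zeroD(3)[of _ "unit_exp (of_int b2 * (x / of_int R))"]) auto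
  then have 1: "3 * (of_int b1 * (x / of_int R)) \<in> \<int>"
    by (simp add: unit_exp_power unit_exp_eq_1_iff)
  obtain j where j: "R = 3 * j" using three_dvd_R by (auto simp: dvd_def)
  have "of_int j * (3 * (of_int b1 * (x / of_int R))) \<in> \<int>" by (rule Ints_mult[OF Ints_of_int 1])
  also have "of_int j * (3 * (of_int b1 * (x / of_int R))) = of_int b1 * x"
    using j R_nonzero by (simp add: field_simps)
  finally show ?thesis .
qed

text \<open>Orthogonality to the row 0 shows that a letter k with value z at b1 has value w = -1 - z
  at b2. Hence x/R and k/R give the same two exponentials, and those of (x - k)/R are 1. Two such
  letters are supplied by \<open>branching\<close>.\<close>

lemma mask_zero_branches:
  assumes "mask (x / of_int R) = 0"
  obtains l l' where "l \<in> L" "l' \<in> L" "\<not> R dvd l - l'"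
    "mask ((x - of_int l) / of_int R) = 1" "mask ((x - of_int l') / of_int R) = 1"
proof -
  define z where "z = unit_exp (of_int b1 * (x / of_int R))"
  define w where "w = unit_exp (of_int b2 * (x / of_int R))"
  have zw: "1 + z + w = 0" using assms by (simp add: mask_eq z_def w_def)
  have "norm z = 1" "norm w = 1" by (simp_all add: z_def w_def)
  note z = unit_complex_sum_zeroD(1,4)[OF this zw]
  obtain l l' where l: "l \<in> L" "l' \<in> L" "unit_exp (of_int (l * b1) / of_int R) = z"
      "unit_exp (of_int (l' * b1) / of_int R) = z" "\<not> R dvd l - l'"
    using branching[OF z(1)] by blast
  have "mask ((x - of_int k) / of_int R) = 1" if k: "k \<in> L" "unit_exp (of_int (k * b1) / of_int R) = z" for k
  proof -
    have "k \<noteq> 0" using k(2) z(2) by auto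
    then have "(\<Sum>c\<in>{0, b1, b2}. unit_exp (of_int (k * c) / of_int R)) = 0"
      using k(1) a_nonzero by (intro orthogonal_columns_row_sum_zero[OF orth card_B finite_L zero_in_L a_0]) auto
    then have kz: "1 + z + unit_exp (of_int (k * b2) / of_int R) = 0"
      using b1_nonzero b2_nonzero b1_neq_b2 k(2) by (simp add: add_ac)
    have kw: "unit_exp (of_int (k * b2) / of_int R) = w" using kz zw by (metis add_left_cancel)
    have e: "unit_exp (of_int b * ((x - of_int k) / of_int R)) = unit_exp (of_int b * (x / of_int R)) * cnj (unit_exp (of_int (k * b) / of_int R))" for b
      unfolding unit_exp_diff[symmetric] by (rule arg_cong[where f = unit_exp]) (simp add: field_simps)
    have n: "v * cnj v = 1" if "norm v = 1" for v using that by (simp flip: complex_norm_square)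
    have "norm z = 1" "norm w = 1" by (simp_all add: z_def w_def)
    then show ?thesis
      unfolding mask_eq e k(2) kw z_def[symmetric] w_def[symmetric] by (simp add: n)
  qed
  with l show thesis using that by blast
qed

lemma limit_defect_zero: "limit_defect t = 0"
proof (rule ccontr)
  assume t: "limit_defect t \<noteq> 0"
  define C where "C = real_of_int (\<Sum>l\<in>L. \<bar>l\<bar>)"
  \<comment> \<open>Both K >= |t| and K >= C hold, so t lies in the interval, and |x - l| <= 2 K <=
    |R| K for |x| <= K makes it invariant.\<close>
  define K where "K = \<bar>t\<bar> + C"
  have C: "\<bar>real_of_int l\<bar> \<le> C" if "l \<in> L" for l
  proof -
    have "\<bar>l\<bar> \<le> (\<Sum>l\<in>L. \<bar>l\<bar>)" using finite_L that by (intro member_le_sum) auto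
    then show ?thesis unfolding C_def by linarith
  qed
  have "C \<ge> 0" by (simp add: C_def sum_nonneg)
  then have K: "K \<ge> 0" "\<bar>t\<bar> \<le> K" "C \<le> K" by (auto simp: K_def)
  have inv: "(x - of_int l) / of_int R \<in> {-K..K}" if "x \<in> {-K..K}" "l \<in> L" for x l
  proof -
    have "\<bar>x - of_int l\<bar> \<le> K * 2" using that C[OF that(2)] K by auto
    also have "\<dots> \<le> K * \<bar>of_int R\<bar>" using abs_R_ge_2 K by (intro mult_left_mono) linarith+
    finally have "\<bar>(x - of_int l) / of_int R\<bar> \<le> K"
      by (simp add: abs_divide pos_divide_le_eq)
    then show ?thesis unfolding abs_le_iff atLeastAtMost_iff by linarith
  qed
  obtain x0 where x0: "x0 \<in> {-K..K}" "\<And>y. y \<in> {-K..K} \<Longrightarrow> limit_defect y \<le> limit_defect x0"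
    using limit_defect_attains_max[OF K(1)] by blast
  define c where "c = limit_defect x0"
  have le_c: "limit_defect y \<le> c" if "y \<in> {-K..K}" for y using x0 that by (simp add: c_def)
  have "t \<in> {-K..K}" using K(2) by (simp add: abs_le_iff)
  then have c_pos: "c > 0" using le_c[of t] t limit_defect_nonneg[of t] by linarith
  define M where "M = {x \<in> {-K..K}. limit_defect x = c}"
  \<comment> \<open>Maximum principle: the maximal value c is a convex combination of values at most
    c, so every successor with positive weight takes the value c as well.\<close>
  have step: "(x - of_int l) / of_int R \<in> M"
    if x: "x \<in> M" and l: "l \<in> L" and m: "mask ((x - of_int l) / of_int R) \<noteq> 0" for x l
  proof -
    let ?y = "\<lambda>l. (x - of_int l) / of_int R"
    let ?p = "\<lambda>l. (norm (a l))\<^sup>2 * (norm (mask (?y l)))\<^sup>2"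
    have xI: "x \<in> {-K..K}" using x by (simp add: M_def)
    have "(\<Sum>l\<in>L. ?p l * (c - limit_defect (?y l))) = c * (\<Sum>l\<in>L. ?p l) - limit_defect x"
      by (subst limit_defect_eq[of x], simp only: right_diff_distrib sum_subtractf)
        (simp only: sum_distrib_left mult_ac)
    also have "\<dots> = 0" using x by (simp only: sum_norm_mask) (simp add: M_def)
    finally have "(\<Sum>l\<in>L. ?p l * (c - limit_defect (?y l))) = 0" .
    moreover have "\<forall>l\<in>L. 0 \<le> ?p l * (c - limit_defect (?y l))"
      using le_c[OF inv[OF xI]] by (intro ballI mult_nonneg_nonneg) auto
    ultimately have "?p l * (c - limit_defect (?y l)) = 0"
      using finite_L l sum_nonneg_eq_0_iff[of L "\<lambda>l. ?p l * (c - limit_defect (?y l))"] by blast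
    then have "limit_defect (?y l) = c" using a_nonzero[OF l] m by simp
    then show ?thesis using inv[OF xI l] by (simp add: M_def)
  qed
  have step0: "x / of_int R \<in> M" if "x \<in> M" "mask (x / of_int R) \<noteq> 0" for x
    using step[OF that(1) zero_in_L] that(2) by simp
  \<comment> \<open>Otherwise the points x/R^k all stay in M and tend to 0, and upper semicontinuity
    gives c <= g(0) = 0.\<close>
  have blocked: "\<exists>k. x / of_int R ^ k \<in> M \<and> mask (x / of_int R ^ k / of_int R) = 0" if x: "x \<in> M" for x
  proof (rule ccontr)
    assume "\<not> ?thesis"
    then have nz: "mask (x / of_int R ^ k / of_int R) \<noteq> 0" if "x / of_int R ^ k \<in> M" for k using that by blast
    have all: "x / of_int R ^ k \<in> M" for k
    proof (induction k)
      case (Suc k)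
      then show ?case using step0[OF Suc nz[OF Suc]] by (simp add: mult.commute)
    qed (use x in simp)
    have "(\<lambda>k. x * inverse (of_int R) ^ k) \<longlonglongrightarrow> x * 0"
    proof (intro tendsto_intros LIMSEQ_power_zero)
      have "\<bar>real_of_int R\<bar> > 1" using abs_R_ge_2 by linarith
      then show "norm (inverse (real_of_int R)) < 1" by (simp add: inverse_less_1_iff)
    qed
    then have "(\<lambda>k. x / of_int R ^ k) \<longlonglongrightarrow> 0" by (simp add: power_inverse divide_inverse)
    moreover have "(\<lambda>k. limit_defect (x / of_int R ^ k)) \<longlonglongrightarrow> c" using all by (simp add: M_def)
    ultimately have "c \<le> limit_defect 0" by (rule limit_defect_upper_semicontinuous)
    with c_pos show False by (simp add: limit_defect_0)
  qed
  \<comment> \<open>At the zero of the mask reached from x, b1 x/R^k is an integer; multiplying back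
    by R^k places M in a lattice, and a bounded subset of a lattice is finite.\<close>
  have ints: "of_int b1 * x \<in> \<int>" if x: "x \<in> M" for x
  proof -
    obtain k where k: "mask (x / of_int R ^ k / of_int R) = 0" using blocked[OF x] by blast
    have "of_int R ^ k * (of_int b1 * (x / of_int R ^ k)) \<in> \<int>"
      by (intro Ints_mult Ints_power mask_zeroD[OF k]) auto
    then show ?thesis by simp
  qed
  have finM: "finite M"
  proof (rule finite_subset)
    define N where "N = \<lceil>\<bar>of_int b1\<bar> * K\<rceil>"
    show "M \<subseteq> (\<lambda>j. of_int j / of_int b1) ` {-N..N}"
    proof
      fix x assume x: "x \<in> M"
      obtain j :: int where j: "of_int b1 * x = of_int j" using ints[OF x] by (auto simp: Ints_def)
      have "\<bar>x\<bar> \<le> K" using x by (auto simp: M_def)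
      then have "\<bar>of_int b1 * x\<bar> \<le> \<bar>of_int b1\<bar> * K" by (simp add: abs_mult mult_left_mono)
      then have "\<bar>real_of_int j\<bar> \<le> of_int N" unfolding j N_def by linarith
      then have "j \<in> {-N..N}" by auto
      moreover have "x = of_int j / of_int b1" using j b1_nonzero by (simp add: field_simps)
      ultimately show "x \<in> (\<lambda>j. of_int j / of_int b1) ` {-N..N}" by blast
    qed
  qed simp
  \<comment> \<open>Modulo 1 every successor of \<open>x\<close> is a preimage of \<open>x\<close> under multiplication by \<open>R\<close>, so this map is
    onto, hence injective, on the finite set of fractional parts; two branches at a zero of the mask contradict this.\<close>
  define \<phi> where "\<phi> y = frac (of_int R * y)" for y :: real
  have \<phi>: "\<phi> (frac ((x - of_int l) / of_int R)) = frac x" for x l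
  proof -
    let ?y = "(x - of_int l) / of_int R :: real"
    have "of_int R * frac ?y = x + of_int (- l - R * \<lfloor>?y\<rfloor>)"
      by (simp add: frac_def field_simps)
    then show ?thesis unfolding \<phi>_def by (simp add: frac_def)
  qed
  have "frac ` M \<subseteq> \<phi> ` (frac ` M)"
  proof safe
    fix x assume x: "x \<in> M"
    show "frac x \<in> \<phi> ` frac ` M"
    proof (cases "mask (x / of_int R) = 0")
      case True
      then obtain l where "l \<in> L" "mask ((x - of_int l) / of_int R) = 1"
        using mask_zero_branches by metis
      then have "(x - of_int l) / of_int R \<in> M" using step[OF x] by simp
      then show ?thesis using \<phi>[of x l] by (metis imageI)
    next
      case False
      then have "x / of_int R \<in> M" using step0[OF x] by blast
      then show ?thesis using \<phi>[of x 0] by (metis imageI diff_zero of_int_0)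
    qed
  qed
  then have inj: "inj_on \<phi> (frac ` M)" using finM by (intro finite_surj_inj) auto
  have "x0 \<in> M" using x0 by (simp add: M_def c_def)
  then obtain x where x: "x \<in> M" "mask (x / of_int R) = 0" using blocked by blast
  obtain l l' where l: "l \<in> L" "l' \<in> L" "\<not> R dvd l - l'"
      "mask ((x - of_int l) / of_int R) = 1" "mask ((x - of_int l') / of_int R) = 1"
    using mask_zero_branches[OF x(2)] by metis
  have lM: "(x - of_int l) / of_int R \<in> M" "(x - of_int l') / of_int R \<in> M"
    using step[OF x(1)] l by auto
  have "frac ((x - of_int l) / of_int R) = frac ((x - of_int l') / of_int R)"
    by (rule inj_onD[OF inj _ imageI[OF lM(1)] imageI[OF lM(2)]]) (simp only: \<phi>)
  then have "(x - of_int l) / of_int R - (x - of_int l') / of_int R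
      = of_int (\<lfloor>(x - of_int l) / of_int R\<rfloor> - \<lfloor>(x - of_int l') / of_int R\<rfloor>)"
    unfolding frac_def of_int_diff by linarith
  then obtain j :: int where "(x - of_int l) / of_int R - (x - of_int l') / of_int R = of_int j" by blast
  then have "((x - of_int l) - (x - of_int l')) / of_int R = of_int j"
    by (simp only: diff_divide_distrib)
  then have "real_of_int (l' - l) = of_int (R * j)" by (simp add: divide_eq_eq mult.commute)
  then have "l' - l = R * j" by linarith
  then have "R dvd l - l'" by (metis dvd_diff_commute dvd_triv_left)
  with l(3) show False by blast
qed

lemma reproduced_expo: "reproduced (expo t)"
  using limit_defect[of t] by (simp add: reproduced_def square_integrable_expo limit_defect_zero)

end

section \<open>Density of the exponentials\<close>

text \<open>Frequencies are arbitrary reals rather than integers, so that sines of any period are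
  available to separate the points of a long interval.\<close>

inductive trig_poly :: "(real \<Rightarrow> complex) \<Rightarrow> bool" where
  expo: "trig_poly (expo t)"
| cmult: "trig_poly f \<Longrightarrow> trig_poly (\<lambda>x. c * f x)"
| add: "trig_poly f \<Longrightarrow> trig_poly g \<Longrightarrow> trig_poly (\<lambda>x. f x + g x)"

lemma expo_mult: "expo s x * expo t x = expo (s + t) x"
  by (simp add: expo_eq_unit_exp distrib_right flip: unit_exp_add)

lemma trig_poly_mult:
  assumes "trig_poly f" "trig_poly g"
  shows "trig_poly (\<lambda>x. f x * g x)"
  using assms(1)
proof induction
  case (expo s)
  show ?case using assms(2)
  proof induction
    case (expo t)
    show ?case by (simp add: expo_mult trig_poly.expo)
  next
    case (cmult f c)
    from trig_poly.cmult[OF cmult.IH, of c] show ?case by (simp add: mult_ac)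
  next
    case (add f g)
    from trig_poly.add[OF add.IH] show ?case by (simp add: distrib_left)
  qed
next
  case (cmult f c)
  from trig_poly.cmult[OF cmult.IH, of c] show ?case by (simp add: mult_ac)
next
  case (add f h)
  from trig_poly.add[OF add.IH] show ?case by (simp add: distrib_right)
qed

lemma continuous_on_trig_poly: "trig_poly f \<Longrightarrow> continuous_on A f"
proof (induction rule: trig_poly.induct)
  case (expo t)
  show ?case unfolding expo_eq_unit_exp by (intro continuous_intros)
qed (auto intro!: continuous_intros)

lemma trig_poly_const: "trig_poly (\<lambda>x. c)"
  using trig_poly.cmult[OF trig_poly.expo[of 0], of c] by (simp add: expo_eq_unit_exp)

lemma trig_poly_sin: "trig_poly (\<lambda>x. complex_of_real (sin (2 * pi * (s * x))))"
proof -
  have "trig_poly (\<lambda>x. (- \<i> / 2) * expo s x + (\<i> / 2) * expo (- s) x)"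
    by (intro trig_poly.intros)
  moreover have "(- \<i> / 2) * expo s x + (\<i> / 2) * expo (- s) x = complex_of_real (sin (2 * pi * (s * x)))" for x
    by (simp add: expo_eq_unit_exp unit_exp_def complex_eq_iff)
  ultimately show ?thesis by simp
qed

text \<open>Stone-Weierstrass for the algebra of real functions that are trigonometric polynomials
  when read as complex functions; a single sine of long period separates the points.\<close>

lemma trig_poly_approximation:
  fixes f :: "real \<Rightarrow> real"
  assumes "continuous_on {-K..K} f" "e > 0" "K > 0"
  obtains g where "trig_poly (\<lambda>x. complex_of_real (g x))" "\<And>x. x \<in> {-K..K} \<Longrightarrow> \<bar>f x - g x\<bar> < e"
proof -
  interpret function_ring_on "{g :: real \<Rightarrow> real. trig_poly (\<lambda>x. complex_of_real (g x))}" "{-K..K}"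
  proof
    fix g :: "real \<Rightarrow> real" assume "g \<in> {g. trig_poly (\<lambda>x. complex_of_real (g x))}"
    then have "continuous_on {-K..K} (\<lambda>x. Re (complex_of_real (g x)))"
      by (intro continuous_intros continuous_on_trig_poly) simp
    then show "continuous_on {-K..K} g" by simp
  next
    fix x y :: real assume xy: "x \<in> {-K..K}" "y \<in> {-K..K}" "x \<noteq> y"
    \<comment> \<open>With this frequency the argument of the sine runs through [-pi/2, pi/2], where
      the sine is injective.\<close>
    define s where "s = 1 / (4 * K)"
    have "sin (2 * pi * (s * x)) \<noteq> sin (2 * pi * (s * y))"
    proof
      assume eq: "sin (2 * pi * (s * x)) = sin (2 * pi * (s * y))"
      have r: "- (pi / 2) \<le> 2 * pi * (s * z) \<and> 2 * pi * (s * z) \<le> pi / 2" if "z \<in> {-K..K}" for z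
      proof -
        have "2 * pi * (s * z) = (pi / 2) * (z / K)" using assms(3) by (simp add: s_def)
        moreover have "-1 \<le> z / K" "z / K \<le> 1" using that assms(3) by (auto simp: field_simps)
        then have "(pi / 2) * (-1) \<le> (pi / 2) * (z / K)" "(pi / 2) * (z / K) \<le> (pi / 2) * 1"
          by (intro mult_left_mono; simp)+
        ultimately show ?thesis by simp
      qed
      have "2 * pi * (s * x) = 2 * pi * (s * y)"
        using sin_inj_pi[of "2 * pi * (s * x)" "2 * pi * (s * y)"] r[OF xy(1)] r[OF xy(2)] eq by simp
      then show False using xy(3) assms(3) by (simp add: s_def)
    qed
    then show "\<exists>f\<in>{g. trig_poly (\<lambda>x. complex_of_real (g x))}. f x \<noteq> f y"
      by (intro bexI[of _ "\<lambda>x. sin (2 * pi * (s * x))"] CollectI trig_poly_sin)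
  qed (auto simp: trig_poly_const trig_poly.add trig_poly_mult)
  show thesis using Stone_Weierstrass_basic[OF assms(1,2)] that by auto
qed

section \<open>From exponentials to all square-integrable functions\<close>

context weighted_fourier_system
begin

text \<open>Dominated convergence turns pointwise convergence into convergence in L^2, under which
  reproduced functions are closed. The bound 4 |h|^2 comes from |f - s_k| <= 2 |h|.\<close>

lemma reproduced_dominated_limit:
  assumes s: "\<And>k. reproduced (s k)" and f: "f \<in> borel_measurable \<mu>" and h: "square_integrable \<mu> h"
    and lim: "\<And>x. (\<lambda>k. s k x) \<longlonglongrightarrow> f x" and le: "\<And>k x. norm (s k x) \<le> norm (h x)"
  shows "reproduced f"
proof (rule reproduced_closed)
  have fh: "norm (f x) \<le> norm (h x)" for x
    by (rule LIMSEQ_le_const2[OF tendsto_norm[OF lim]]) (use le in blast)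
  then show "square_integrable \<mu> f" by (intro square_integrable_bound[OF f h]) auto
  have [measurable]: "s k \<in> borel_measurable \<mu>" for k
    using s by (simp add: reproduced_def square_integrable_def)
  note f[measurable]
  have "(\<lambda>k. LINT x|\<mu>. (norm (f x - s k x))\<^sup>2) \<longlonglongrightarrow> (LINT x|\<mu>. 0)"
  proof (rule integral_dominated_convergence[where w = "\<lambda>x. 4 * (norm (h x))\<^sup>2"])
    show "integrable \<mu> (\<lambda>x. 4 * (norm (h x))\<^sup>2)" using h by (simp add: square_integrable_def)
    show "AE x in \<mu>. (\<lambda>k. (norm (f x - s k x))\<^sup>2) \<longlonglongrightarrow> 0"
    proof (rule AE_I2)
      fix x
      have "(\<lambda>k. (norm (f x - s k x))\<^sup>2) \<longlonglongrightarrow> (norm (f x - f x))\<^sup>2"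
        by (intro tendsto_intros lim)
      then show "(\<lambda>k. (norm (f x - s k x))\<^sup>2) \<longlonglongrightarrow> 0" by simp
    qed
    show "AE x in \<mu>. norm ((norm (f x - s k x))\<^sup>2) \<le> 4 * (norm (h x))\<^sup>2" for k
    proof (rule AE_I2)
      fix x
      have "norm (f x - s k x) \<le> 2 * norm (h x)"
        using norm_triangle_ineq4[of "f x" "s k x"] fh[of x] le[of k x] by linarith
      then have "(norm (f x - s k x))\<^sup>2 \<le> (2 * norm (h x))\<^sup>2" by (intro power_mono) auto
      then show "norm ((norm (f x - s k x))\<^sup>2) \<le> 4 * (norm (h x))\<^sup>2" by (simp add: power_mult_distrib)
    qed
  qed measurable
  then have "(\<lambda>k. sq_norm \<mu> (\<lambda>x. f x - s k x)) \<longlonglongrightarrow> 0" by (simp add: sq_norm_def)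
  note lim0 = this
  fix e :: real assume "e > 0"
  from order_tendstoD(2)[OF lim0 this]
  obtain k where "sq_norm \<mu> (\<lambda>x. f x - s k x) < e"
    using eventually_happens'[OF sequentially_bot] by blast
  with s show "\<exists>g. reproduced g \<and> sq_norm \<mu> (\<lambda>x. f x - g x) < e" by blast
qed

lemma reproduced_trig_poly:
  assumes "\<And>t. reproduced (expo t)" "trig_poly f"
  shows "reproduced f"
  using assms(2) by induction (auto simp: assms(1) reproduced_cmult reproduced_add)

text \<open>Because mu has bounded support, uniform approximation by trigonometric polynomials on
  one compact interval is approximation in L^2.\<close>

lemma reproduced_continuous:
  fixes f :: "real \<Rightarrow> real"
  assumes "\<And>t. reproduced (expo t)" "continuous_on UNIV f" "\<And>x. \<bar>f x\<bar> \<le> 1"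
  shows "reproduced (\<lambda>x. complex_of_real (f x))"
proof (rule reproduced_closed)
  have "(\<lambda>x. complex_of_real (f x)) \<in> borel_measurable \<mu>"
    by (intro continuous_on_imp_measurable_mu continuous_intros assms)
  then show sf: "square_integrable \<mu> (\<lambda>x. complex_of_real (f x))"
    by (rule square_integrable_bound[where g = "\<lambda>_. 1"]) (use assms(3) in \<open>auto simp: square_integrable_def\<close>)
  fix e :: real assume e: "e > 0"
  \<comment> \<open>Chosen at most 1, so that d * d <= d < e bounds the squared error.\<close>
  define d where "d = min 1 (e / 2)"
  have d: "d > 0" "d * d < e"
  proof -
    show "d > 0" using e by (simp add: d_def)
    then have "d * d \<le> d * 1" by (intro mult_left_mono) (auto simp: d_def)
    also have "\<dots> < e" using e by (simp add: d_def min_def)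
    finally show "d * d < e" .
  qed
  obtain K0 where "AE x in \<mu>. \<bar>x\<bar> \<le> K0"
    using self_similar_measure_bounded_support[OF self_similar card_B abs_R_ge_2] by blast
  then have AE: "AE x in \<mu>. x \<in> {-(max 1 K0)..max 1 K0}" by eventually_elim auto
  obtain g where g: "trig_poly (\<lambda>x. complex_of_real (g x))"
      "\<And>x. x \<in> {-(max 1 K0)..max 1 K0} \<Longrightarrow> \<bar>f x - g x\<bar> < d"
    by (rule trig_poly_approximation[OF continuous_on_subset[OF assms(2) subset_UNIV] d(1), of "max 1 K0"]) auto
  have rg: "reproduced (\<lambda>x. complex_of_real (g x))" by (rule reproduced_trig_poly[OF assms(1) g(1)])
  then have "square_integrable \<mu> (\<lambda>x. complex_of_real (f x) - complex_of_real (g x))"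
    by (intro square_integrable_diff sf) (simp add: reproduced_def)
  then have int: "integrable \<mu> (\<lambda>x. (norm (complex_of_real (f x) - complex_of_real (g x)))\<^sup>2)"
    by (simp add: square_integrable_def)
  have "AE x in \<mu>. (norm (complex_of_real (f x) - complex_of_real (g x)))\<^sup>2 \<le> d * d"
    using AE
  proof eventually_elim
    case (elim x)
    have "norm (complex_of_real (f x) - complex_of_real (g x)) = \<bar>f x - g x\<bar>"
      by (simp flip: of_real_diff)
    then show ?case using g(2)[OF elim] d(1) by (simp add: power2_eq_square abs_mult_self_eq mult_mono less_imp_le del: abs_mult_self_eq)
  qed
  then have "sq_norm \<mu> (\<lambda>x. complex_of_real (f x) - complex_of_real (g x)) \<le> (LINT x|\<mu>. d * d)"
    unfolding sq_norm_def by (intro integral_mono_AE int) auto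
  also have "\<dots> < e" using prob_space d(2) by simp
  finally show "\<exists>g. reproduced g \<and> sq_norm \<mu> (\<lambda>x. complex_of_real (f x) - g x) < e" using rg by blast
qed

lemma reproduced_indicator_atMost:
  assumes "\<And>t. reproduced (expo t)"
  shows "reproduced (\<lambda>x. indicator {..u} x)"
proof (rule reproduced_dominated_limit)
  \<comment> \<open>Continuous ramps: equal to 1 up to u and, for k > 0, falling linearly to 0 on
    [u, u + 1/k].\<close>
  let ?s = "\<lambda>(k::nat) x. max 0 (min 1 (1 - real k * (x - u)))"
  show "reproduced (\<lambda>x. complex_of_real (?s k x))" for k
    by (rule reproduced_continuous[OF assms]) (auto intro!: continuous_intros)
  show "square_integrable \<mu> (\<lambda>_. 1)" by (simp add: square_integrable_def)
  show "(\<lambda>x. indicator {..u} x) \<in> borel_measurable \<mu>" by measurable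
  show "norm (complex_of_real (?s k x)) \<le> norm (1::complex)" for k x by (simp add: norm_of_real)
  show "(\<lambda>k. complex_of_real (?s k x)) \<longlonglongrightarrow> indicator {..u} x" for x
  proof (cases "x \<le> u")
    case True
    then have "real k * (x - u) \<le> 0" for k by (simp add: mult_nonneg_nonpos)
    then have "?s k x = 1" for k by (auto simp: max_def min_def)
    with True show ?thesis by simp
  next
    case False
    obtain N where N: "1 < real N * (x - u)" using False reals_Archimedean3[of "x - u"] by auto
    have "?s k x = 0" if "k \<ge> N" for k
    proof -
      have "real N * (x - u) \<le> real k * (x - u)" using that False by (intro mult_right_mono) auto
      then show ?thesis using N by (auto simp: max_def min_def)
    qed
    then have "\<forall>\<^sub>F k in sequentially. complex_of_real (?s k x) = indicator {..u} x"
      using False by (intro eventually_sequentiallyI[of N]) auto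
    then show ?thesis by (rule tendsto_eventually)
  qed
qed

text \<open>Dynkin's argument: half-lines form an intersection-stable generator, and the class of
  Borel sets with reproduced indicator is closed under complements and countable disjoint
  unions.\<close>

lemma reproduced_indicator:
  assumes "\<And>t. reproduced (expo t)" "A \<in> sets borel"
  shows "reproduced (\<lambda>x. indicator A x)"
proof -
  have one: "reproduced (\<lambda>x. 1)" 
  proof -
    have "expo 0 = (\<lambda>x. 1)" by (rule ext) (simp add: expo_eq_unit_exp)
    with assms(1)[of 0] show ?thesis by simp
  qed
  let ?G = "range (\<lambda>a::real. {..a})"
  have bor: "sets borel = sigma_sets UNIV ?G" by (simp add: borel_eq_atMost)
  have "Int_stable ?G" by (auto simp: Int_stable_def)
  moreover have "?G \<subseteq> Pow UNIV" by simp
  moreover have "A \<in> sigma_sets UNIV ?G" using assms(2) bor by simp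
  ultimately show ?thesis
  proof (induction rule: sigma_sets_induct_disjoint)
    case (basic A)
    then show ?case using reproduced_indicator_atMost[OF assms(1)] by auto
  next
    case empty
    then show ?case by (simp add: reproduced_zero)
  next
    case (compl A)
    have "(\<lambda>x. indicator (UNIV - A) x) = (\<lambda>x. 1 - indicator A x :: complex)"
      by (auto simp: indicator_def)
    with reproduced_diff[OF one compl(2)] show ?case by simp
  next
    case (union A)
    show ?case
    proof (rule reproduced_dominated_limit)
      show "reproduced (\<lambda>x. \<Sum>i<k. indicator (A i) x)" for k
        by (intro reproduced_sum union) auto
      have "A i \<in> sets borel" for i using union(2) bor by blast
      then show "(\<lambda>x. indicator (\<Union>i. A i) x) \<in> borel_measurable \<mu>" by (intro borel_measurable_indicator) auto
      show "square_integrable \<mu> (\<lambda>_. 1)" by (simp add: square_integrable_def)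
      have eq: "(\<Sum>i<k. indicator (A i) x) = (indicator (\<Union>i<k. A i) x :: complex)" for k x
        by (rule indicator_UN_disjoint[symmetric]) (use union(1) in \<open>auto simp: disjoint_family_on_def\<close>)
      then show "norm (\<Sum>i<k. indicator (A i) x :: complex) \<le> norm (1::complex)" for k x
        by (simp add: indicator_def)
      show "(\<lambda>k. \<Sum>i<k. indicator (A i) x) \<longlonglongrightarrow> (indicator (\<Union>i. A i) x :: complex)" for x
        unfolding eq by (rule LIMSEQ_indicator_UN)
    qed
  qed
qed

text \<open>Simple functions that converge pointwise to f and are bounded by 2 |f| reduce the claim
  to indicators.\<close>

lemma reproduced_of_exponentials:
  assumes "\<And>t. reproduced (expo t)" "square_integrable \<mu> f"
  shows "reproduced f"
proof -
  have f: "f \<in> borel_measurable \<mu>" using assms(2) by (simp add: square_integrable_def)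
  obtain s where s: "\<And>i. simple_function \<mu> (s i)" "\<And>x. (\<lambda>i. s i x) \<longlonglongrightarrow> f x"
      "\<And>i x. norm (s i x) \<le> 2 * norm (f x)"
    using borel_measurable_implies_sequence_metric[OF f, of 0] by auto
  have "reproduced (s i)" for i
  proof -
    have fin: "finite (range (s i))" using s(1)[of i] by (simp add: simple_function_def)
    have "s i -` {y} \<in> sets borel" if "y \<in> range (s i)" for y
      using s(1)[of i] that by (auto simp: simple_function_def)
    then have "reproduced (\<lambda>x. \<Sum>y\<in>range (s i). y * indicator (s i -` {y}) x)"
      by (intro reproduced_sum fin reproduced_cmult reproduced_indicator assms(1))
    moreover have "(\<Sum>y\<in>range (s i). y * indicator (s i -` {y}) x) = s i x" for x
      using fin by (simp add: indicator_def if_distrib[of "\<lambda>u. _ * u"] cong: if_cong)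
    ultimately show ?thesis by simp
  qed
  then show ?thesis
    by (rule reproduced_dominated_limit[OF _ f square_integrable_cmult[OF assms(2), of 2] s(2)])
      (use s(3) in \<open>simp add: norm_mult\<close>)
qed

end

section \<open>The frame property and its link to condition (v)\<close>

lemma (in branching_fourier_system) parseval_frame_words:
  "parseval_frame \<mu> (Omega L) (\<lambda>w x. word_coeff a w * expo (of_int (word_freq R w)) x)"
  unfolding parseval_frame_def
proof (intro allI impI)
  fix f :: "real \<Rightarrow> complex"
  assume "f \<in> borel_measurable \<mu> \<and> integrable \<mu> (\<lambda>x. (norm (f x))\<^sup>2)"
  then have "square_integrable \<mu> f" by (simp add: square_integrable_def)
  from reproduced_imp_has_sum[OF reproduced_of_exponentials[OF reproduced_expo this]]
  show "((\<lambda>w. (norm (LINT x|\<mu>. f x * cnj (word_coeff a w * expo (of_int (word_freq R w)) x)))\<^sup>2)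
    has_sum (LINT x|\<mu>. (norm (f x))\<^sup>2)) (Omega L)"
    unfolding coefficient_def sq_norm_def .
qed

text \<open>With w = e(r q1/3), letters with \<open>s l\<close> congruent to 1 modulo 3 have value w
  at b1 and those congruent to 2 have value w^2. Every primitive cube root is one of these two, and
  condition (v) supplies two letters for each, incongruent modulo R.\<close>

lemma factorisation_imp_branching:
  fixes R b1 :: int and L :: "int set" and s :: "int \<Rightarrow> int" and z :: complex
  assumes R: "R \<noteq> 0"
    and st: "1 \<le> \<alpha>" "R = 3 ^ \<alpha> * r" "\<not> 3 dvd r" "b1 = 3 ^ \<beta> * q1" "\<beta> \<le> \<alpha> - 1" "\<not> 3 dvd q1"
    and s: "\<And>l. l \<in> L - {0} \<Longrightarrow> l = 3 ^ (\<alpha> - 1 - \<beta>) * s l \<and> r dvd q1 * s l"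
    and l: "l1 \<in> L - {0}" "l1' \<in> L - {0}" "l2 \<in> L - {0}" "l2' \<in> L - {0}"
      "s l1 mod 3 = 1" "s l1' mod 3 = 1" "s l2 mod 3 = 2" "s l2' mod 3 = 2"
      "l1 mod R \<noteq> l1' mod R" "l2 mod R \<noteq> l2' mod R"
    and z: "z\<^sup>2 + z + 1 = 0"
  shows "\<exists>l\<in>L. \<exists>l'\<in>L. unit_exp (of_int (l * b1) / of_int R) = z \<and>
    unit_exp (of_int (l' * b1) / of_int R) = z \<and> \<not> R dvd l - l'"
proof -
  define w where "w = unit_exp (of_int (r * q1) / 3)"
  have r0: "r \<noteq> 0" using R st by auto
  have e: "unit_exp (of_int (l * b1) / of_int R) = w ^ nat (s l mod 3)" if "l \<in> L - {0}" for l
    unfolding w_def st(4) using s[OF that] st r0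
    by (intro unit_exp_factored_ratio[of \<alpha>]) auto
  have "\<not> 3 dvd r * q1" using st(3,6) by (simp add: prime_elem_dvd_mult_iff)
  then have "w\<^sup>2 + w + 1 = 0" unfolding w_def by (rule unit_exp_third_root)
  from primitive_cube_root_cases[OF this z] show ?thesis
  proof
    assume "z = w"
    then show ?thesis
      using e[OF l(1)] e[OF l(2)] l by (intro bexI[of _ l1] bexI[of _ l1']) (auto simp: mod_eq_dvd_iff)
  next
    assume "z = w\<^sup>2"
    then show ?thesis
      using e[OF l(3)] e[OF l(4)] l by (intro bexI[of _ l2] bexI[of _ l2']) (auto simp: mod_eq_dvd_iff)
  qed
qed

theorem theorem5p10:
  fixes R b1 b2 :: int and L :: "int set" and a :: "int \<Rightarrow> complex" and \<mu> :: "real measure"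
  assumes R: "\<bar>R\<bar> \<ge> 2"
    and B: "b1 \<noteq> 0" "b2 \<noteq> 0" "b1 \<noteq> b2"
    and L: "finite L" "0 \<in> L"
    and a: "\<forall>l\<in>L. a l \<noteq> 0" "a 0 = 1"
    and mu: "self_similar_measure R {0, b1, b2} \<mu>"
  shows
    "((\<forall>c\<in>{0, b1, b2}. \<forall>c'\<in>{0, b1, b2}.
         (\<Sum>l\<in>L. (exp (2 * pi * \<i> * of_int (l * c) / of_int R) * a l / sqrt 3)
                 * cnj (exp (2 * pi * \<i> * of_int (l * c') / of_int R) * a l / sqrt 3))
         = (if c = c' then 1 else 0))
      \<longleftrightarrow>
      (\<exists>(\<alpha>::nat) (r::int) (\<beta>::nat) (q1::int) (q2::int) (s::int \<Rightarrow> int).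
         \<alpha> \<ge> 1 \<and> R = 3 ^ \<alpha> * r \<and> \<not> 3 dvd r \<and>
         b1 = 3 ^ \<beta> * q1 \<and> b2 = 3 ^ \<beta> * q2 \<and> \<beta> \<le> \<alpha> - 1 \<and>
         \<not> 3 dvd q1 \<and> \<not> 3 dvd q2 \<and> q1 mod 3 \<noteq> q2 mod 3 \<and>
         (\<forall>l\<in>L - {0}. l = 3 ^ (\<alpha> - 1 - \<beta>) * s l \<and> \<not> 3 dvd s l \<and>
                        r dvd q1 * s l \<and> r dvd q2 * s l) \<and>
         (\<Sum>l\<in>{l\<in>L - {0}. s l mod 3 = 1}. (cmod (a l))\<^sup>2) = 1 \<and>
         (\<Sum>l\<in>{l\<in>L - {0}. s l mod 3 = 2}. (cmod (a l))\<^sup>2) = 1))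
     \<and>
     (\<forall>(\<alpha>::nat) (r::int) (\<beta>::nat) (q1::int) (q2::int) (s::int \<Rightarrow> int).
         (\<alpha> \<ge> 1 \<and> R = 3 ^ \<alpha> * r \<and> \<not> 3 dvd r \<and>
          b1 = 3 ^ \<beta> * q1 \<and> b2 = 3 ^ \<beta> * q2 \<and> \<beta> \<le> \<alpha> - 1 \<and>
          \<not> 3 dvd q1 \<and> \<not> 3 dvd q2 \<and> q1 mod 3 \<noteq> q2 mod 3 \<and>
          (\<forall>l\<in>L - {0}. l = 3 ^ (\<alpha> - 1 - \<beta>) * s l \<and> \<not> 3 dvd s l \<and>
                         r dvd q1 * s l \<and> r dvd q2 * s l) \<and>
          (\<Sum>l\<in>{l\<in>L - {0}. s l mod 3 = 1}. (cmod (a l))\<^sup>2) = 1 \<and>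
          (\<Sum>l\<in>{l\<in>L - {0}. s l mod 3 = 2}. (cmod (a l))\<^sup>2) = 1 \<and>
          (\<exists>l1\<in>L - {0}. \<exists>l1'\<in>L - {0}. \<exists>l2\<in>L - {0}. \<exists>l2'\<in>L - {0}.
             s l1 mod 3 = 1 \<and> s l1' mod 3 = 1 \<and> s l2 mod 3 = 2 \<and> s l2' mod 3 = 2 \<and>
             l1 mod R \<noteq> l1' mod R \<and> l2 mod R \<noteq> l2' mod R))
       \<longrightarrow> parseval_frame \<mu> (Omega L)
             (\<lambda>w x. word_coeff a w * expo (of_int (word_freq R w)) x))"
proof (intro conjI allI impI, unfold orthonormal_columns_iff)
  have R0: "R \<noteq> 0" using R by auto
  show "orthogonal_columns R {0, b1, b2} L a \<longleftrightarrow>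
      (\<exists>(\<alpha>::nat) (r::int) (\<beta>::nat) (q1::int) (q2::int) (s::int \<Rightarrow> int).
         \<alpha> \<ge> 1 \<and> R = 3 ^ \<alpha> * r \<and> \<not> 3 dvd r \<and>
         b1 = 3 ^ \<beta> * q1 \<and> b2 = 3 ^ \<beta> * q2 \<and> \<beta> \<le> \<alpha> - 1 \<and>
         \<not> 3 dvd q1 \<and> \<not> 3 dvd q2 \<and> q1 mod 3 \<noteq> q2 mod 3 \<and>
         (\<forall>l\<in>L - {0}. l = 3 ^ (\<alpha> - 1 - \<beta>) * s l \<and> \<not> 3 dvd s l \<and>
                        r dvd q1 * s l \<and> r dvd q2 * s l) \<and>
         (\<Sum>l\<in>{l\<in>L - {0}. s l mod 3 = 1}. (cmod (a l))\<^sup>2) = 1 \<and>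
         (\<Sum>l\<in>{l\<in>L - {0}. s l mod 3 = 2}. (cmod (a l))\<^sup>2) = 1)" (is "?orth \<longleftrightarrow> ?cond")
  proof
    assume ?orth
    then show ?cond by (rule orthogonal_columns_imp_factorisation[OF R0 B L a])
  next
    assume ?cond
    then show ?orth by (elim exE conjE) (rule factorisation_imp_orthogonal_columns[where a = a, OF R0 L a(2)])
  qed
next
  fix \<alpha> \<beta> :: nat and r q1 q2 :: int and s :: "int \<Rightarrow> int"
  assume "\<alpha> \<ge> 1 \<and> R = 3 ^ \<alpha> * r \<and> \<not> 3 dvd r \<and>
          b1 = 3 ^ \<beta> * q1 \<and> b2 = 3 ^ \<beta> * q2 \<and> \<beta> \<le> \<alpha> - 1 \<and>
          \<not> 3 dvd q1 \<and> \<not> 3 dvd q2 \<and> q1 mod 3 \<noteq> q2 mod 3 \<and>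
          (\<forall>l\<in>L - {0}. l = 3 ^ (\<alpha> - 1 - \<beta>) * s l \<and> \<not> 3 dvd s l \<and>
                         r dvd q1 * s l \<and> r dvd q2 * s l) \<and>
          (\<Sum>l\<in>{l\<in>L - {0}. s l mod 3 = 1}. (cmod (a l))\<^sup>2) = 1 \<and>
          (\<Sum>l\<in>{l\<in>L - {0}. s l mod 3 = 2}. (cmod (a l))\<^sup>2) = 1 \<and>
          (\<exists>l1\<in>L - {0}. \<exists>l1'\<in>L - {0}. \<exists>l2\<in>L - {0}. \<exists>l2'\<in>L - {0}.
             s l1 mod 3 = 1 \<and> s l1' mod 3 = 1 \<and> s l2 mod 3 = 2 \<and> s l2' mod 3 = 2 \<and>
             l1 mod R \<noteq> l1' mod R \<and> l2 mod R \<noteq> l2' mod R)"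
  then obtain l1 l1' l2 l2' where st: "1 \<le> \<alpha>" "R = 3 ^ \<alpha> * r" "\<not> 3 dvd r"
      "b1 = 3 ^ \<beta> * q1" "b2 = 3 ^ \<beta> * q2" "\<beta> \<le> \<alpha> - 1"
      "\<not> 3 dvd q1" "\<not> 3 dvd q2" "q1 mod 3 \<noteq> q2 mod 3"
    and s: "\<forall>l\<in>L - {0}. l = 3 ^ (\<alpha> - 1 - \<beta>) * s l \<and> \<not> 3 dvd s l \<and> r dvd q1 * s l \<and> r dvd q2 * s l"
    and PQ: "(\<Sum>l\<in>{l\<in>L - {0}. s l mod 3 = 1}. (cmod (a l))\<^sup>2) = 1"
      "(\<Sum>l\<in>{l\<in>L - {0}. s l mod 3 = 2}. (cmod (a l))\<^sup>2) = 1"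
    and l: "l1 \<in> L - {0}" "l1' \<in> L - {0}" "l2 \<in> L - {0}" "l2' \<in> L - {0}"
      "s l1 mod 3 = 1" "s l1' mod 3 = 1" "s l2 mod 3 = 2" "s l2' mod 3 = 2"
      "l1 mod R \<noteq> l1' mod R" "l2 mod R \<noteq> l2' mod R"
    by blast
  have R0: "R \<noteq> 0" using R by auto
  have "branching_fourier_system R b1 b2 L a \<mu>"
  proof
    show "card {0, b1, b2} = 3" using B by simp
    show "orthogonal_columns R {0, b1, b2} L a"
      by (rule factorisation_imp_orthogonal_columns[where a = a, OF R0 L a(2) st s PQ])
    show "3 dvd R" using st(1,2) by (simp add: dvd_power)
    show "\<exists>l\<in>L. \<exists>l'\<in>L. unit_exp (of_int (l * b1) / of_int R) = z \<and>
        unit_exp (of_int (l' * b1) / of_int R) = z \<and> \<not> R dvd l - l'" if "z\<^sup>2 + z + 1 = 0" for z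
      by (rule factorisation_imp_branching[OF R0 st(1-4,6,7) _ l that]) (use s in blast)
  qed (use R B L a mu in auto)
  then show "parseval_frame \<mu> (Omega L) (\<lambda>w x. word_coeff a w * expo (of_int (word_freq R w)) x)"
    by (rule branching_fourier_system.parseval_frame_words)
qed

end
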